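(* Let $G$ be a graph. Then $\mathrm{smt}(G)=\mathrm{rank}(G)$.
   Context: $G=(V,E)$ is a finite simple undirected graph with $V=[m]$. $\mathbb{S}_m$ is the space of real symmetric $m\times m$ matrices; $L_G=\{K\in\mathbb{S}_m: K_{ij}=0 \text{ whenever } i\ne j \text{ and } ij\notin E\}$ and $\Pi_G$ is the orthogonal projection of $\mathbb{S}_m$ onto $L_G$. Given $n$ observations forming the columns... more precisely a data matrix $P\in\mathbb{R}^{n\times m}$ with sample covariance $\Sigma_0=P^TP$, the score matching estimator (SME) exists if the linear equation $\tfrac12\Pi_G(K\Sigma_0^T+\Sigma_0K^T)=I_m$ has a unique solution $K\in L_G$. $G$ is $n$-estimable if the SME exists with probability one (for Lebesgue-almost all $P\in\mathbb{R}^{n\times m}$); the score matching threshold $\mathrm{smt}(G)$ is the minimal $n$ such that $G$ is $n$-estimable. $Sym(m,n)$ is the set of symmetric $m\times m$ matrices of rank at most $n$, $\phi_G(\Sigma)=(\sigma_{ii})_{i\in V}\oplus(\sigma_{ij})_{ij\in E}$, and $\mathrm{rank}(G)$ is the smallest $n$ with $\dim\phi_G(Sym(m,n))=\#V+\#E$. *)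

theory Defs
  imports
    "HOL-Analysis.Analysis"
    "Jordan_Normal_Form.DL_Rank"
begin

hide_const (open) Finite_Cartesian_Product.mat Finite_Cartesian_Product.transpose
  Cartesian_Space.rank
no_notation Finite_Cartesian_Product.vec_nth (infixl \<open>$\<close> 90)

(* Matrices are 0-indexed here, so the vertex set [m] is {..<m}; an edge ij is the set {i, j}. *)

definition simple_graph :: "nat \<Rightarrow> nat set set \<Rightarrow> bool" where
  "simple_graph m E \<longleftrightarrow> E \<subseteq> {{i, j} | i j. i < m \<and> j < m \<and> i \<noteq> j}"

definition sym_mats :: "nat \<Rightarrow> real mat set" where
  "sym_mats m = {A \<in> carrier_mat m m. A\<^sup>T = A}"

definition L_space :: "nat \<Rightarrow> nat set set \<Rightarrow> real mat set" where
  "L_space m E = {K \<in> sym_mats m. \<forall>i<m. \<forall>j<m. i \<noteq> j \<and> {i, j} \<notin> E \<longrightarrow> K $$ (i, j) = 0}"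

definition frob_inner :: "nat \<Rightarrow> real mat \<Rightarrow> real mat \<Rightarrow> real" where
  "frob_inner m A B = (\<Sum>i<m. \<Sum>j<m. A $$ (i, j) * B $$ (i, j))"

definition proj_L :: "nat \<Rightarrow> nat set set \<Rightarrow> real mat \<Rightarrow> real mat" where
  "proj_L m E A = (THE B. B \<in> L_space m E \<and> (\<forall>K \<in> L_space m E. frob_inner m (A - B) K = 0))"

(* The description is well defined on symmetric matrices, with the expected entries. *)
lemma proj_L_eq:
  assumes A: "A \<in> sym_mats m"
  shows "proj_L m E A = mat m m (\<lambda>(i, j). if i = j \<or> {i, j} \<in> E then A $$ (i, j) else 0)"
    (is "_ = ?B")
proof -
  have Ac: "A \<in> carrier_mat m m" and At: "A\<^sup>T = A" using A by (auto simp: sym_mats_def)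
  have Aji: "A $$ (j, i) = A $$ (i, j)" if "i < m" "j < m" for i j
    using At Ac that by (metis carrier_matD index_transpose_mat(1))
  have BL: "?B \<in> L_space m E"
    unfolding L_space_def sym_mats_def
    by (auto intro!: eq_matI simp: insert_commute Aji)
  have orth: "frob_inner m (A - ?B) K = 0" if "K \<in> L_space m E" for K
    unfolding frob_inner_def using that Ac
    by (intro sum.neutral ballI) (auto simp: L_space_def)
  show ?thesis unfolding proj_L_def
  proof (rule the_equality)
    show "?B \<in> L_space m E \<and> (\<forall>K \<in> L_space m E. frob_inner m (A - ?B) K = 0)"
      using BL orth by blast
  next
    fix B assume B: "B \<in> L_space m E \<and> (\<forall>K \<in> L_space m E. frob_inner m (A - B) K = 0)"
    have Bc: "B \<in> carrier_mat m m" and Bt: "B\<^sup>T = B"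
      using B by (auto simp: L_space_def sym_mats_def)
    have Bji: "B $$ (j, i) = B $$ (i, j)" if "i < m" "j < m" for i j
      using Bt Bc that by (metis carrier_matD index_transpose_mat(1))
    let ?D = "?B - B"
    have D: "?D \<in> L_space m E"
      using BL B Bc unfolding L_space_def sym_mats_def
      by (auto intro!: eq_matI simp: insert_commute Aji Bji)
    have "frob_inner m (A - B) ?D - frob_inner m (A - ?B) ?D = frob_inner m ?D ?D"
      unfolding frob_inner_def sum_subtractf[symmetric] using Ac Bc
      by (intro sum.cong refl) (auto simp: algebra_simps)
    then have "frob_inner m ?D ?D = 0" using B D orth by simp
    then have "\<forall>i<m. \<forall>j<m. ?D $$ (i, j) = 0"
      unfolding frob_inner_def
      by (subst (asm) sum_nonneg_eq_0_iff; simp add: sum_nonneg sum_nonneg_eq_0_iff)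
    then show "B = ?B" using Bc by (intro eq_matI) auto
  qed
qed

definition sme_exists :: "nat \<Rightarrow> nat set set \<Rightarrow> real mat \<Rightarrow> bool" where
  "sme_exists m E P \<longleftrightarrow>
     (let S = P\<^sup>T * P
      in \<exists>!K. K \<in> L_space m E \<and> (1/2) \<cdot>\<^sub>m proj_L m E (K * S\<^sup>T + S * K\<^sup>T) = 1\<^sub>m m)"

(* The product of the one-dimensional Lebesgue measures is Lebesgue measure on n x m matrices. *)
definition estimable :: "nat \<Rightarrow> nat set set \<Rightarrow> nat \<Rightarrow> bool" where
  "estimable m E n \<longleftrightarrow>
     (AE p in PiM ({..<n} \<times> {..<m}) (\<lambda>_. lborel :: real measure). sme_exists m E (mat n m p))"

definition smt :: "nat \<Rightarrow> nat set set \<Rightarrow> nat" where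
  "smt m E = (LEAST n. estimable m E n)"

(* Affine space over the reals with coordinates indexed by I is I \<rightarrow>\<^sub>E UNIV. *)

inductive_set poly_funs :: "'i set \<Rightarrow> (('i \<Rightarrow> real) \<Rightarrow> real) set" for I where
  const: "(\<lambda>_. c) \<in> poly_funs I"
| coord: "i \<in> I \<Longrightarrow> (\<lambda>x. x i) \<in> poly_funs I"
| add: "f \<in> poly_funs I \<Longrightarrow> g \<in> poly_funs I \<Longrightarrow> (\<lambda>x. f x + g x) \<in> poly_funs I"
| mult: "f \<in> poly_funs I \<Longrightarrow> g \<in> poly_funs I \<Longrightarrow> (\<lambda>x. f x * g x) \<in> poly_funs I"

definition zariski_closed :: "'i set \<Rightarrow> ('i \<Rightarrow> real) set \<Rightarrow> bool" where
  "zariski_closed I Z \<longleftrightarrow> (\<exists>F \<subseteq> poly_funs I. Z = {x \<in> I \<rightarrow>\<^sub>E UNIV. \<forall>f \<in> F. f x = 0})"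

definition zariski_irreducible :: "'i set \<Rightarrow> ('i \<Rightarrow> real) set \<Rightarrow> bool" where
  "zariski_irreducible I Z \<longleftrightarrow> Z \<noteq> {} \<and>
     (\<forall>A B. zariski_closed I A \<and> zariski_closed I B \<and> Z \<subseteq> A \<union> B \<longrightarrow> Z \<subseteq> A \<or> Z \<subseteq> B)"

(* Krull dimension of the Zariski closure: the supremum of the lengths k of strict chains
   Z 0 < ... < Z k of irreducible closed subsets. The empty set gets 0 instead of minus infinity. *)
definition alg_dim :: "'i set \<Rightarrow> ('i \<Rightarrow> real) set \<Rightarrow> enat" where
  "alg_dim I S = Sup {enat k | k. \<exists>Z :: nat \<Rightarrow> ('i \<Rightarrow> real) set.
     (\<forall>i\<le>k. zariski_closed I (Z i) \<and> zariski_irreducible I (Z i) \<and> Z i \<subseteq> zariski_closed I hull S) \<and>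
     (\<forall>i<k. Z i \<subset> Z (Suc i))}"

definition sym_rank_le :: "nat \<Rightarrow> nat \<Rightarrow> real mat set" where
  "sym_rank_le m n = {A \<in> sym_mats m. vec_space.rank m A \<le> n}"

definition coords :: "nat \<Rightarrow> nat set set \<Rightarrow> (nat + nat set) set" where
  "coords m E = {..<m} <+> E"

(* On an edge e = {i, j} the value is the entry (i, j), unambiguous since matrices are symmetric. *)
definition phi :: "nat \<Rightarrow> nat set set \<Rightarrow> real mat \<Rightarrow> (nat + nat set) \<Rightarrow> real" where
  "phi m E A = (\<lambda>c \<in> coords m E. case c of Inl i \<Rightarrow> A $$ (i, i) | Inr e \<Rightarrow> A $$ (Min e, Max e))"

definition graph_rank :: "nat \<Rightarrow> nat set set \<Rightarrow> nat" where
  "graph_rank m E =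
     (LEAST n. alg_dim (coords m E) (phi m E ` sym_rank_le m n) = enat (card {..<m} + card E))"

end

theory Submission
  imports Defs
begin

text \<open>Fix \<open>n\<close> and call \<open>P\<close> regular if no nonzero \<open>K\<close> in \<open>L_space\<close> satisfies \<open>P * K = 0\<close>. The inner product of
  \<open>K\<close> with \<open>K * S + S * K\<close>, \<open>S = P\<^sup>T * P\<close>, is twice the squared norm of \<open>P * K\<close>, so the estimator exists
  iff \<open>P\<close> is regular, and this says that \<open>P \<mapsto> phi (P\<^sup>T * P)\<close> is a submersion at \<open>P\<close>. At a regular point the
  lowest-order term of a polynomial vanishing on the image of this map is zero, so the image is Zariski
  dense. Conversely, if the image of the matrices of rank at most \<open>n\<close>, which are the matrices
  \<open>P\<^sup>T * (M + M\<^sup>T) * P\<close>, is dense, the Jacobian criterion in characteristic zero yields a nonzero polynomial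
  in \<open>P\<close> outside whose zero set \<open>P\<close> is regular. Finally, density is equivalent to full dimension, because
  polynomials separating the members of a chain of irreducible sets are algebraically independent.\<close>

section \<open>Polynomial functions\<close>

text \<open>A real symmetric matrix of rank at most \<open>n\<close> need not be positive
  semidefinite, so Gram matrices do not exhaust \<open>sym_rank_le m n\<close>. This is why the two
  directions use different maps. Gram matrices of regular \<open>P\<close> suffice for density,
  since they lie in that set. For the converse the middle factor \<open>M + M\<^sup>T\<close>
  supplies every signature while leaving all variables free of constraints, but the polynomial from
  the Jacobian criterion then involves \<open>M\<close> too. Regularity concerns \<open>P\<close>
  alone, so \<open>M\<close> is frozen at a point where this polynomial does not vanish. The link
  between the two maps is that \<open>P * K = 0\<close> makes \<open>K\<close> orthogonal to every
  tangent direction of \<open>P\<^sup>T * (M + M\<^sup>T) * P\<close>, whatever \<open>M\<close> is.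
  Polynomials are represented by functions, without formal degrees or monomials. Hence degrees are
  bounded along lines, and algebraic dependence of too many polynomials comes from counting grid
  points.\<close>

lemma poly_funs_cong:
  assumes "f \<in> poly_funs I" "\<And>i. i \<in> I \<Longrightarrow> x i = y i"
  shows "f x = f y"
  using assms by induction auto

lemma poly_funs_minus:
  assumes "f \<in> poly_funs I" "g \<in> poly_funs I"
  shows "(\<lambda>x. f x - g x) \<in> poly_funs I"
  using poly_funs.add[OF assms(1) poly_funs.mult[OF poly_funs.const[of "-1"] assms(2)]] by simp

lemma poly_funs_sum:
  assumes "\<And>a. a \<in> A \<Longrightarrow> f a \<in> poly_funs I"
  shows "(\<lambda>x. \<Sum>a\<in>A. f a x) \<in> poly_funs I"
  using assms by (induction A rule: infinite_finite_induct) (auto intro: poly_funs.intros)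

lemma poly_funs_prod:
  assumes "\<And>a. a \<in> A \<Longrightarrow> f a \<in> poly_funs I"
  shows "(\<lambda>x. \<Prod>a\<in>A. f a x) \<in> poly_funs I"
  using assms by (induction A rule: infinite_finite_induct) (auto intro: poly_funs.intros)

lemma poly_funs_power:
  assumes "f \<in> poly_funs I"
  shows "(\<lambda>x. f x ^ k) \<in> poly_funs I"
  using assms by (induction k) (auto intro: poly_funs.intros)

lemma poly_funs_compose:
  assumes "f \<in> poly_funs I" "\<And>i. i \<in> I \<Longrightarrow> g i \<in> poly_funs J"
  shows "(\<lambda>x. f (\<lambda>i. g i x)) \<in> poly_funs J"
  using assms by induction (auto intro: poly_funs.intros)

lemma poly_funs_curve:
  assumes "f \<in> poly_funs I" "\<And>i. i \<in> I \<Longrightarrow> \<exists>p. \<forall>s. c s i = poly p s"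
  shows "\<exists>p. \<forall>s. f (c s) = poly p s"
  using assms
proof induction
  case (const c)
  show ?case by (rule exI[of _ "[:c:]"]) simp
next
  case (add f g)
  then obtain p q where "\<forall>s. f (c s) = poly p s" "\<forall>s. g (c s) = poly q s" by blast
  then show ?case by (intro exI[of _ "p + q"]) simp
next
  case (mult f g)
  then obtain p q where "\<forall>s. f (c s) = poly p s" "\<forall>s. g (c s) = poly q s" by blast
  then show ?case by (intro exI[of _ "p * q"]) simp
qed auto

lemma poly_funs_line:
  assumes "f \<in> poly_funs I"
  shows "\<exists>p. \<forall>s. f (\<lambda>i. x i + s * d i) = poly p s"
proof (rule poly_funs_curve[OF assms])
  show "\<exists>p. \<forall>s. x i + s * d i = poly p s" for i
    by (rule exI[of _ "[:x i, d i:]"]) simp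
qed

text \<open>Along the line through \<open>x\<close> and \<open>y\<close> both become nonzero
  univariate polynomials, as \<open>s = 0\<close> and \<open>s = 1\<close> show, and their product
  has a non-root. This is what makes affine spaces irreducible.\<close>

lemma poly_funs_common_nonzero_on_line:
  assumes f: "f \<in> poly_funs I" "f x \<noteq> 0" and g: "g \<in> poly_funs I" "g y \<noteq> 0"
  shows "\<exists>s. f (\<lambda>i. x i + s * (y i - x i)) \<noteq> 0 \<and> g (\<lambda>i. x i + s * (y i - x i)) \<noteq> 0"
proof -
  obtain p where p: "\<And>s. f (\<lambda>i. x i + s * (y i - x i)) = poly p s"
    using poly_funs_line[OF f(1), of x "\<lambda>i. y i - x i"] by auto
  obtain q where q: "\<And>s. g (\<lambda>i. x i + s * (y i - x i)) = poly q s"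
    using poly_funs_line[OF g(1), of x "\<lambda>i. y i - x i"] by auto
  have "p \<noteq> 0" using p[of 0] f(2) by auto
  moreover have "q \<noteq> 0" using q[of 1] g(2) by auto
  ultimately have "p * q \<noteq> 0" by simp
  then obtain s where "poly (p * q) s \<noteq> 0" using poly_all_0_iff_0 by blast
  then show ?thesis using p q by auto
qed

lemma poly_funs_prod_nonzero:
  assumes "finite A" "\<And>a. a \<in> A \<Longrightarrow> f a \<in> poly_funs I" "\<And>a. a \<in> A \<Longrightarrow> \<exists>x. f a x \<noteq> 0"
  shows "\<exists>x. (\<Prod>a\<in>A. f a x) \<noteq> 0"
  using assms
proof (induction A)
  case (insert a A)
  from insert.prems(2)[of a] obtain y where y: "f a y \<noteq> 0" by auto
  from insert.IH insert.prems obtain x where x: "(\<Prod>a\<in>A. f a x) \<noteq> 0" by blast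
  have "(\<lambda>x. \<Prod>a\<in>A. f a x) \<in> poly_funs I" using insert by (auto intro: poly_funs_prod)
  moreover have "f a \<in> poly_funs I" using insert.prems by simp
  ultimately obtain z where "(\<Prod>a\<in>A. f a z) \<noteq> 0" "f a z \<noteq> 0"
    using poly_funs_common_nonzero_on_line[of "\<lambda>x. \<Prod>a\<in>A. f a x" I x "f a" y] x y by blast
  then show ?case using insert.hyps by (intro exI[of _ z]) simp
qed auto

text \<open>Sorting by powers of the coordinate \<open>i\<close>. The coefficient sequence is total
  with a zero tail: this is the form \<open>polynomial_product\<close> takes, and it lets sums be
  padded to a common bound.\<close>

lemma poly_funs_insert_expand:
  assumes "f \<in> poly_funs (insert i I)"
  shows "\<exists>a d. (\<forall>l. a l \<in> poly_funs I) \<and> (\<forall>l>d. a l = (\<lambda>_. 0)) \<and>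
           (\<forall>y. f y = (\<Sum>l\<le>d. a l y * y i ^ l))"
  using assms
proof induction
  case (const c)
  show ?case
    by (rule exI[of _ "\<lambda>l. if l = 0 then (\<lambda>_. c) else (\<lambda>_. 0)"], rule exI[of _ 0])
       (auto intro: poly_funs.intros)
next
  case (coord j)
  show ?case
  proof (cases "j = i")
    case True
    then show ?thesis
      by (intro exI[of _ "\<lambda>l. if l = 1 then (\<lambda>_. 1) else (\<lambda>_. 0)"] exI[of _ 1])
         (auto intro: poly_funs.intros)
  next
    case False
    then have "j \<in> I" using coord by auto
    then show ?thesis
      by (intro exI[of _ "\<lambda>l. if l = 0 then (\<lambda>y. y j) else (\<lambda>_. 0)"] exI[of _ 0])
         (auto intro: poly_funs.intros)
  qed
next
  case (add f g)
  from add.IH(1) obtain a d where a: "\<And>l. a l \<in> poly_funs I" "\<And>l. l > d \<Longrightarrow> a l = (\<lambda>_. 0)"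
    "\<And>y. f y = (\<Sum>l\<le>d. a l y * y i ^ l)" by auto
  from add.IH(2) obtain b e where b: "\<And>l. b l \<in> poly_funs I" "\<And>l. l > e \<Longrightarrow> b l = (\<lambda>_. 0)"
    "\<And>y. g y = (\<Sum>l\<le>e. b l y * y i ^ l)" by auto
  have fx: "f y = (\<Sum>l\<le>max d e. a l y * y i ^ l)" for y
    unfolding a(3) by (rule sum.mono_neutral_left) (auto simp: a(2))
  have gx: "g y = (\<Sum>l\<le>max d e. b l y * y i ^ l)" for y
    unfolding b(3) by (rule sum.mono_neutral_left) (auto simp: b(2))
  show ?case
    by (rule exI[of _ "\<lambda>l y. a l y + b l y"], rule exI[of _ "max d e"])
       (auto simp: fx gx sum.distrib algebra_simps a(2) b(2) intro: poly_funs.add a(1) b(1))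
next
  case (mult f g)
  from mult.IH(1) obtain a d where a: "\<And>l. a l \<in> poly_funs I" "\<And>l. l > d \<Longrightarrow> a l = (\<lambda>_. 0)"
    "\<And>y. f y = (\<Sum>l\<le>d. a l y * y i ^ l)" by auto
  from mult.IH(2) obtain b e where b: "\<And>l. b l \<in> poly_funs I" "\<And>l. l > e \<Longrightarrow> b l = (\<lambda>_. 0)"
    "\<And>y. g y = (\<Sum>l\<le>e. b l y * y i ^ l)" by auto
  have "f y * g y = (\<Sum>r\<le>d + e. (\<Sum>k\<le>r. a k y * b (r - k) y) * y i ^ r)" for y
    unfolding a(3) b(3) by (rule polynomial_product) (auto simp: a(2) b(2))
  moreover have "(\<lambda>y. \<Sum>k\<le>r. a k y * b (r - k) y) = (\<lambda>_. 0)" if "r > d + e" for r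
  proof (rule ext, rule sum.neutral, rule ballI)
    fix y k assume "k \<in> {..r}"
    show "a k y * b (r - k) y = 0"
      using a(2)[of k] b(2)[of "r - k"] that by (cases "k > d") auto
  qed
  ultimately show ?case
    by (intro exI[of _ "\<lambda>r y. \<Sum>k\<le>r. a k y * b (r - k) y"] exI[of _ "d + e"])
       (auto intro!: poly_funs_sum poly_funs.mult a(1) b(1))
qed

text \<open>Cutting the expansion at the largest index whose coefficient is not identically zero
  makes the leading coefficient a nonzero function.\<close>

lemma poly_funs_insert_expand_nonzero:
  assumes f: "f \<in> poly_funs (insert i I)" and nz: "f z \<noteq> 0"
  obtains a d where "\<And>l. a l \<in> poly_funs I" "\<And>y. f y = (\<Sum>l\<le>d. a l y * y i ^ l)"
    "\<exists>y. a d y \<noteq> 0"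
proof -
  obtain a d where a: "\<And>l. a l \<in> poly_funs I" "\<And>y. f y = (\<Sum>l\<le>d. a l y * y i ^ l)"
    using poly_funs_insert_expand[OF f] by auto
  let ?L = "{l. l \<le> d \<and> (\<exists>y. a l y \<noteq> 0)}"
  have fin: "finite ?L" by simp
  have ne: "?L \<noteq> {}"
  proof
    assume "?L = {}"
    then have "f z = 0" unfolding a(2) by (intro sum.neutral) auto
    then show False using nz by simp
  qed
  define e where "e = Max ?L"
  have e: "e \<in> ?L" unfolding e_def by (rule Max_in[OF fin ne])
  have "a l y = 0" if "l > e" "l \<le> d" for l y
    using that Max_ge[OF fin, of l] unfolding e_def by fastforce
  then have "f y = (\<Sum>l\<le>e. a l y * y i ^ l)" for y
    unfolding a(2) using e by (intro sum.mono_neutral_right) auto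
  then show ?thesis using that[of a e] a(1) e by auto
qed

text \<open>\<open>D\<close> is the gradient at \<open>x\<close>. One \<open>D\<close> serves all
  directions \<open>w\<close>, so stationarity becomes a linear equation in \<open>w\<close> and
  dimension counts apply.\<close>

lemma poly_funs_gradient:
  assumes "f \<in> poly_funs I" "finite I"
  shows "\<exists>D. \<forall>w. ((\<lambda>s. f (\<lambda>i. x i + s * w i)) has_real_derivative (\<Sum>i\<in>I. w i * D i)) (at 0)"
  using assms
proof induction
  case (const c)
  show ?case by (rule exI[of _ "\<lambda>_. 0"]) simp
next
  case (coord j)
  show ?case
  proof (rule exI[of _ "\<lambda>i. if i = j then 1 else 0"], rule allI)
    fix w :: "_ \<Rightarrow> real"
    have "(\<Sum>i\<in>I. w i * (if i = j then 1 else 0)) = w j"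
      using coord by (simp add: if_distrib sum.delta cong: if_cong)
    moreover have "((\<lambda>s. x j + s * w j) has_real_derivative w j) (at 0)"
      by (auto intro!: derivative_eq_intros)
    ultimately show "((\<lambda>s. x j + s * w j) has_real_derivative
        (\<Sum>i\<in>I. w i * (if i = j then 1 else 0))) (at 0)" by simp
  qed
next
  case (add f g)
  then obtain D D' where
    D: "\<And>w. ((\<lambda>s. f (\<lambda>i. x i + s * w i)) has_real_derivative (\<Sum>i\<in>I. w i * D i)) (at 0)" and
    D': "\<And>w. ((\<lambda>s. g (\<lambda>i. x i + s * w i)) has_real_derivative (\<Sum>i\<in>I. w i * D' i)) (at 0)"
    by blast
  show ?case
  proof (intro exI[of _ "\<lambda>i. D i + D' i"] allI)
    show "((\<lambda>s. f (\<lambda>i. x i + s * w i) + g (\<lambda>i. x i + s * w i)) has_real_derivative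
        (\<Sum>i\<in>I. w i * (D i + D' i))) (at 0)" for w
      using DERIV_add[OF D[of w] D'[of w]] by (simp add: distrib_left sum.distrib)
  qed
next
  case (mult f g)
  then obtain D D' where
    D: "\<And>w. ((\<lambda>s. f (\<lambda>i. x i + s * w i)) has_real_derivative (\<Sum>i\<in>I. w i * D i)) (at 0)" and
    D': "\<And>w. ((\<lambda>s. g (\<lambda>i. x i + s * w i)) has_real_derivative (\<Sum>i\<in>I. w i * D' i)) (at 0)"
    by blast
  show ?case
  proof (intro exI[of _ "\<lambda>i. D i * g x + D' i * f x"] allI)
    show "((\<lambda>s. f (\<lambda>i. x i + s * w i) * g (\<lambda>i. x i + s * w i)) has_real_derivative
        (\<Sum>i\<in>I. w i * (D i * g x + D' i * f x))) (at 0)" for w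
      using DERIV_mult[OF D[of w] D'[of w]]
      by (simp add: distrib_left sum.distrib sum_distrib_right mult.assoc)
  qed
qed

lemma poly_funs_stationary:
  assumes "f \<in> poly_funs I" "\<And>i. i \<in> I \<Longrightarrow> ((\<lambda>s. c s i) has_real_derivative 0) (at t)"
  shows "((\<lambda>s. f (c s)) has_real_derivative 0) (at t)"
  using assms
proof induction
  case (add f g)
  then show ?case using DERIV_add[of "\<lambda>s. f (c s)" 0 t UNIV "\<lambda>s. g (c s)" 0] by simp
next
  case (mult f g)
  then show ?case using DERIV_mult[of "\<lambda>s. f (c s)" 0 t UNIV "\<lambda>s. g (c s)" 0] by simp
qed auto

text \<open>For \<open>k \<le> d\<close>, \<open>h k\<close> is the homogeneous part of degree
  \<open>k\<close> of \<open>f\<close> recentred at \<open>x\<close>. The identity holds for all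
  \<open>s\<close> and \<open>y\<close> at once, so \<open>y\<close> may later be made to depend on
  \<open>s\<close>.\<close>

lemma poly_funs_taylor:
  assumes "f \<in> poly_funs I"
  shows "\<exists>h d. (\<forall>k. h k \<in> poly_funs I) \<and>
           (\<forall>s y. f (\<lambda>i. x i + s * y i) = (\<Sum>k\<le>d. h k y * s ^ k))"
proof -
  \<comment> \<open>Adjoin \<open>s\<close> as a new coordinate and expand in it.\<close>
  let ?X = "insert None (Some ` I)"
  have "(\<lambda>z. f (\<lambda>i. x i + z None * z (Some i))) \<in> poly_funs ?X"
    by (rule poly_funs_compose[OF assms]) (auto intro!: poly_funs.add poly_funs.mult poly_funs.coord poly_funs.const)
  from poly_funs_insert_expand[OF this] obtain a d where
    a: "\<And>l. a l \<in> poly_funs (Some ` I)"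
       "\<And>z. f (\<lambda>i. x i + z None * z (Some i)) = (\<Sum>l\<le>d. a l z * z None ^ l)" by blast
  \<comment> \<open>The coefficients only see the \<open>Some\<close> coordinates, so the value
    \<open>s\<close> stored at \<open>None\<close> can be replaced by the dummy 0.\<close>
  have "f (\<lambda>i. x i + s * y i) = (\<Sum>k\<le>d. a k (case_option 0 y) * s ^ k)" for s y
  proof -
    have "a k (case_option s y) = a k (case_option 0 y)" for k
      by (rule poly_funs_cong[OF a(1)]) auto
    then show ?thesis using a(2)[of "case_option s y"] by simp
  qed
  moreover have "(\<lambda>y. a k (case_option 0 y)) \<in> poly_funs I" for k
  proof -
    have "(\<lambda>y. a k (\<lambda>o'. case_option 0 y o')) \<in> poly_funs I"
      by (rule poly_funs_compose[OF a(1)]) (auto intro: poly_funs.intros)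
    then show ?thesis by simp
  qed
  ultimately show ?thesis by (intro exI[of _ "\<lambda>k y. a k (case_option 0 y)"] exI[of _ d]) auto
qed

section \<open>Linear systems\<close>

text \<open>Gaussian elimination, by induction on the equations \<open>B\<close>; the unknowns are
  indexed by \<open>A\<close>.\<close>

lemma homogeneous_system_nontrivial:
  fixes c :: "'a \<Rightarrow> 'b \<Rightarrow> real"
  assumes "finite B" "finite A" "card B < card A"
  shows "\<exists>u. (\<exists>a\<in>A. u a \<noteq> 0) \<and> (\<forall>b\<in>B. (\<Sum>a\<in>A. u a * c a b) = 0)"
  using assms
proof (induction B arbitrary: A c)
  case empty
  then have "A \<noteq> {}" by auto
  then show ?case by (intro exI[of _ "\<lambda>_. 1"]) auto
next
  case (insert b0 B)
  show ?case
  proof (cases "\<forall>a\<in>A. c a b0 = 0")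
    case True
    obtain u where "\<exists>a\<in>A. u a \<noteq> 0" "\<forall>b\<in>B. (\<Sum>a\<in>A. u a * c a b) = 0"
      using insert.IH[of A c] insert.prems insert.hyps by auto
    then show ?thesis using True by (intro exI[of _ u]) auto
  next
    case False
    then obtain a0 where a0: "a0 \<in> A" "c a0 b0 \<noteq> 0" by auto
    define A' where "A' = A - {a0}"
    \<comment> \<open>Coefficients after solving equation \<open>b0\<close> for the pivot unknown
      \<open>a0\<close> and substituting; they vanish in column \<open>b0\<close>, so only the
      equations in \<open>B\<close> remain.\<close>
    define c' where "c' a b = c a b - c a b0 / c a0 b0 * c a0 b" for a b
    have A': "finite A'" "a0 \<notin> A'" "A = insert a0 A'" using insert.prems a0 by (auto simp: A'_def)
    then have "card B < card A'" using insert.prems insert.hyps by simp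
    then obtain u' where u': "\<exists>a\<in>A'. u' a \<noteq> 0" "\<forall>b\<in>B. (\<Sum>a\<in>A'. u' a * c' a b) = 0"
      using insert.IH[of A' c'] A' by auto
    define u where "u = u'(a0 := - (\<Sum>a\<in>A'. u' a * (c a b0 / c a0 b0)))"
    have uA': "(\<Sum>a\<in>A'. u a * c a b) = (\<Sum>a\<in>A'. u' a * c a b)" for b
      using A' by (intro sum.cong) (auto simp: u_def)
    have sums: "(\<Sum>a\<in>A. u a * c a b) = (\<Sum>a\<in>A'. u' a * c' a b)" for b
      using A' uA'[of b]
      by (simp add: u_def c'_def algebra_simps sum_subtractf sum_distrib_left sum_distrib_right)
    have "\<exists>a\<in>A. u a \<noteq> 0" using u'(1) A' by (auto simp: u_def)
    moreover have "c' a b0 = 0" for a using a0 by (simp add: c'_def)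
    ultimately show ?thesis using u'(2) by (intro exI[of _ u]) (auto simp: sums)
  qed
qed

lemma injective_system_solvable:
  fixes c :: "'a \<Rightarrow> 'a \<Rightarrow> real"
  assumes fin: "finite A"
    and inj: "\<And>u. (\<And>b. b \<in> A \<Longrightarrow> (\<Sum>a\<in>A. u a * c a b) = 0) \<Longrightarrow> \<forall>a\<in>A. u a = 0"
  shows "\<exists>u. \<forall>b\<in>A. (\<Sum>a\<in>A. u a * c a b) = v b"
proof -
  \<comment> \<open>The extra unknown \<open>None\<close> carries the right-hand side.\<close>
  let ?A = "insert None (Some ` A)"
  have "card A < card ?A" using fin by (simp add: card_image)
  from homogeneous_system_nontrivial[OF fin _ this, of "\<lambda>a' b. case a' of None \<Rightarrow> v b | Some a \<Rightarrow> c a b"] fin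
  obtain u where u: "\<exists>a\<in>?A. u a \<noteq> 0"
    "\<forall>b\<in>A. (\<Sum>a\<in>?A. u a * (case a of None \<Rightarrow> v b | Some a \<Rightarrow> c a b)) = 0" by auto
  have eq: "u None * v b + (\<Sum>a\<in>A. u (Some a) * c a b) = 0" if "b \<in> A" for b
    using u(2)[rule_format, OF that] fin by (simp add: sum.reindex image_iff)
  have nz: "u None \<noteq> 0"
  proof
    assume "u None = 0"
    then have "(\<Sum>a\<in>A. u (Some a) * c a b) = 0" if "b \<in> A" for b using eq[OF that] by simp
    then have "\<forall>a\<in>A. u (Some a) = 0" by (rule inj)
    then show False using u(1) \<open>u None = 0\<close> by auto
  qed
  have "(\<Sum>a\<in>A. - u (Some a) / u None * c a b) = v b" if "b \<in> A" for b
  proof -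
    have "(\<Sum>a\<in>A. - u (Some a) / u None * c a b) = - (\<Sum>a\<in>A. u (Some a) * c a b) / u None"
      by (simp add: sum_divide_distrib sum_negf)
    also have "(\<Sum>a\<in>A. u (Some a) * c a b) = - (u None * v b)" using eq[OF that] by linarith
    finally show ?thesis using nz by simp
  qed
  then show ?thesis by (intro exI[of _ "\<lambda>a. - u (Some a) / u None"]) auto
qed

section \<open>More polynomials than variables are algebraically dependent\<close>

text \<open>A function carries no formal degree, so the bound is imposed on every line parallel to
  axis \<open>i\<close>, uniformly in the base point.\<close>

definition degree_in_le :: "'i \<Rightarrow> nat \<Rightarrow> (('i \<Rightarrow> real) \<Rightarrow> real) \<Rightarrow> bool" where
  "degree_in_le i d f \<longleftrightarrow> (\<forall>x. \<exists>p. degree p \<le> d \<and> (\<forall>s. f (x(i := s)) = poly p s))"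

lemma degree_in_le_mono: "degree_in_le i d f \<Longrightarrow> d \<le> e \<Longrightarrow> degree_in_le i e f"
  unfolding degree_in_le_def by (meson order_trans)

lemma degree_in_le_const: "degree_in_le i d (\<lambda>_. c)"
  unfolding degree_in_le_def by (auto intro!: exI[of _ "[:c:]"])

lemma degree_in_le_coord: "degree_in_le i 1 (\<lambda>x. x j)"
proof (cases "j = i")
  case True
  then show ?thesis unfolding degree_in_le_def by (auto intro!: exI[of _ "[:0, 1:]"])
next
  case False
  show ?thesis unfolding degree_in_le_def
  proof
    fix x :: "_ \<Rightarrow> real"
    show "\<exists>p. degree p \<le> 1 \<and> (\<forall>s. (x(i := s)) j = poly p s)"
      using False by (intro exI[of _ "[:x j:]"]) auto
  qed
qed

lemma degree_in_le_add:
  assumes "degree_in_le i d f" "degree_in_le i d g"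
  shows "degree_in_le i d (\<lambda>x. f x + g x)"
  unfolding degree_in_le_def
proof
  fix x
  obtain p q where "degree p \<le> d" "\<forall>s. f (x(i := s)) = poly p s"
    "degree q \<le> d" "\<forall>s. g (x(i := s)) = poly q s"
    using assms unfolding degree_in_le_def by meson
  then show "\<exists>p. degree p \<le> d \<and> (\<forall>s. f (x(i := s)) + g (x(i := s)) = poly p s)"
    by (intro exI[of _ "p + q"]) (auto intro: degree_add_le)
qed

lemma degree_in_le_mult:
  assumes "degree_in_le i d f" "degree_in_le i e g"
  shows "degree_in_le i (d + e) (\<lambda>x. f x * g x)"
  unfolding degree_in_le_def
proof
  fix x
  obtain p q where "degree p \<le> d" "\<forall>s. f (x(i := s)) = poly p s"
    "degree q \<le> e" "\<forall>s. g (x(i := s)) = poly q s"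
    using assms unfolding degree_in_le_def by meson
  then show "\<exists>p. degree p \<le> d + e \<and> (\<forall>s. f (x(i := s)) * g (x(i := s)) = poly p s)"
    by (intro exI[of _ "p * q"]) (auto intro: order_trans[OF degree_mult_le])
qed

lemma degree_in_le_sum:
  assumes "\<And>a. a \<in> A \<Longrightarrow> degree_in_le i d (f a)"
  shows "degree_in_le i d (\<lambda>x. \<Sum>a\<in>A. f a x)"
  using assms by (induction A rule: infinite_finite_induct)
    (auto intro: degree_in_le_const degree_in_le_add)

lemma degree_in_le_prod:
  assumes "\<And>a. a \<in> A \<Longrightarrow> degree_in_le i d (f a)"
  shows "degree_in_le i (card A * d) (\<lambda>x. \<Prod>a\<in>A. f a x)"
  using assms
proof (induction A rule: infinite_finite_induct)
  case (insert a A)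
  then have "degree_in_le i (d + card A * d) (\<lambda>x. f a x * (\<Prod>a\<in>A. f a x))"
    by (intro degree_in_le_mult) auto
  then show ?case using insert by simp
qed (auto intro: degree_in_le_const)

lemma poly_funs_degree_in_le:
  assumes "f \<in> poly_funs I"
  shows "\<exists>d. \<forall>i. degree_in_le i d f"
  using assms
proof induction
  case (add f g)
  then obtain d e where "\<forall>i. degree_in_le i d f" "\<forall>i. degree_in_le i e g" by blast
  then show ?case
    by (intro exI[of _ "max d e"] allI degree_in_le_add)
       (blast intro: degree_in_le_mono max.cobounded1 max.cobounded2)+
next
  case (mult f g)
  then obtain d e where "\<forall>i. degree_in_le i d f" "\<forall>i. degree_in_le i e g" by blast
  then show ?case by (intro exI[of _ "d + e"] allI degree_in_le_mult) blast+
next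
  case (coord j)
  show ?case by (intro exI[of _ 1] allI degree_in_le_coord)
qed (auto intro: degree_in_le_const)

text \<open>On an axis-parallel line, degree at most \<open>d\<close> and \<open>d + 1\<close> roots
  force zero, so the coordinates can be released from the grid one at a time.\<close>

lemma degree_in_le_zero_on_grid:
  assumes "finite I" and deg: "\<And>i. i \<in> I \<Longrightarrow> degree_in_le i d f"
    and zero: "\<And>x. (\<And>i. i \<in> I \<Longrightarrow> x i \<in> real ` {..d}) \<Longrightarrow> f x = 0"
  shows "f x = 0"
proof -
  \<comment> \<open>\<open>J\<close> collects the coordinates already released.\<close>
  have "finite J \<Longrightarrow> J \<subseteq> I \<Longrightarrow> \<forall>x. (\<forall>i\<in>I - J. x i \<in> real ` {..d}) \<longrightarrow> f x = 0" for J
  proof (induction J rule: finite_induct)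
    case empty
    then show ?case using zero by auto
  next
    case (insert j J)
    show ?case
    proof (intro allI impI)
      fix x assume x: "\<forall>i\<in>I - insert j J. x i \<in> real ` {..d}"
      obtain p where p: "degree p \<le> d" "\<And>s. f (x(j := s)) = poly p s"
        using deg[of j] insert.prems unfolding degree_in_le_def by blast
      have root: "poly p s = 0" if "s \<in> real ` {..d}" for s
      proof -
        have "\<forall>i\<in>I - J. (x(j := s)) i \<in> real ` {..d}" using x that by auto
        then have "f (x(j := s)) = 0" using insert.IH insert.prems by blast
        then show ?thesis by (simp add: p(2))
      qed
      have "p = 0"
      proof (rule ccontr)
        assume "p \<noteq> 0"
        then have "card (real ` {..d}) \<le> card {s. poly p s = 0}"
          using root by (intro card_mono poly_roots_finite) auto
        also have "\<dots> \<le> degree p" by (rule card_poly_roots_bound[OF \<open>p \<noteq> 0\<close>])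
        finally show False using p(1) by (simp add: card_image)
      qed
      then show "f x = 0" using p(2)[of "x j"] by simp
    qed
  qed
  from this[of I] show ?thesis using assms(1) by auto
qed

text \<open>The notion is for indexed families: equal members at distinct indices are dependent.
  Over the reals a polynomial vanishing as a function is the zero polynomial, so this is the usual
  independence.\<close>

definition alg_independent :: "'c set \<Rightarrow> ('c \<Rightarrow> ('i \<Rightarrow> real) \<Rightarrow> real) \<Rightarrow> bool" where
  "alg_independent C g \<longleftrightarrow>
     (\<forall>q\<in>poly_funs C. (\<forall>x. q (\<lambda>c. g c x) = 0) \<longrightarrow> (\<forall>y. q y = 0))"

lemma alg_independentD:
  assumes "alg_independent C g" "q \<in> poly_funs C" "\<And>x. q (\<lambda>c. g c x) = 0"
  shows "q y = 0"
  using assms unfolding alg_independent_def by auto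

text \<open>Polynomials \<open>q\<close> of degree at most \<open>N\<close> in each of the variables indexed by \<open>B\<close> are parametrised
  by their values on the grid \<open>{0..N}\<^sup>B\<close> (Lagrange interpolation), and \<open>q \<circ> g\<close> vanishes as soon as it
  does on a grid with \<open>O(N ^ card I)\<close> points, which is fewer than \<open>(N + 1) ^ card B\<close>.\<close>

lemma alg_independent_card_le:
  assumes fin: "finite I" "finite B" and g: "\<And>b. b \<in> B \<Longrightarrow> g b \<in> poly_funs I"
    and indep: "alg_independent B g"
  shows "card B \<le> card I"
proof (rule ccontr)
  assume "\<not> card B \<le> card I"
  then have card: "card I < card B" by simp
  have "\<forall>b\<in>B. \<exists>d. \<forall>i. degree_in_le i d (g b)" using g poly_funs_degree_in_le by blast
  then obtain db where db: "\<And>b i. b \<in> B \<Longrightarrow> degree_in_le i (db b) (g b)" by metis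
  define d where "d = (\<Sum>b\<in>B. db b)"
  have d: "degree_in_le i d (g b)" if "b \<in> B" for b i
    using db[OF that] member_le_sum[OF that, of db] fin unfolding d_def
    by (intro degree_in_le_mono[OF db[OF that]]) auto
  define k where "k = card B"
  \<comment> \<open>\<open>M\<close> bounds the degree of \<open>L a\<close> composed with
    \<open>g\<close>: \<open>k\<close> blocks of \<open>N\<close> factors of degree at most
    \<open>d\<close>. As \<open>M + 1 \<le> (N + 1) * (k * d + 1)\<close>, the test grid has at most
    \<open>(N + 1) ^ card I * (k * d + 1) ^ card I\<close> points; taking \<open>N\<close> equal to
    the second factor keeps this below \<open>(N + 1) ^ (card I + 1)\<close>.\<close>
  define N where "N = (k * d + 1) ^ card I"
  define M where "M = k * (N * d)"
  define W where "W = B \<rightarrow>\<^sub>E {..N}"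
  define X where "X = I \<rightarrow>\<^sub>E real ` {..M}"
  \<comment> \<open>Unnormalised Lagrange basis: nonzero at the grid point \<open>a\<close>, zero at
    all other points of \<open>W\<close>.\<close>
  define L where "L a y = (\<Prod>b\<in>B. \<Prod>c\<in>{..N} - {a b}. (y b - real c))" for a and y :: "_ \<Rightarrow> real"
  have finW: "finite W" and finX: "finite X" using fin by (auto simp: W_def X_def finite_PiE)
  have "card X = (M + 1) ^ card I" using fin by (simp add: X_def card_PiE card_image)
  also have "\<dots> \<le> ((N + 1) * (k * d + 1)) ^ card I"
    by (rule power_mono) (auto simp: M_def algebra_simps)
  also have "\<dots> = (N + 1) ^ card I * N" by (simp only: power_mult_distrib N_def)
  also have "\<dots> < (N + 1) ^ card I * (N + 1)" by simp
  also have "\<dots> = (N + 1) ^ Suc (card I)" by simp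
  also have "\<dots> \<le> (N + 1) ^ card B" using card by (intro power_increasing) auto
  also have "\<dots> = card W" using fin by (simp add: W_def card_PiE)
  finally have "card X < card W" .
  from homogeneous_system_nontrivial[OF finX finW this, of "\<lambda>a x. L a (\<lambda>b. g b x)"]
  obtain u a0 where a0: "a0 \<in> W" "u a0 \<noteq> 0"
    and u: "\<And>x. x \<in> X \<Longrightarrow> (\<Sum>a\<in>W. u a * L a (\<lambda>b. g b x)) = 0" by blast
  define q where "q y = (\<Sum>a\<in>W. u a * L a y)" for y
  have q: "q \<in> poly_funs B" unfolding q_def L_def
    by (intro poly_funs_sum poly_funs.mult poly_funs.const poly_funs_prod poly_funs_minus poly_funs.coord)
  have qg: "(\<lambda>x. q (\<lambda>b. g b x)) \<in> poly_funs I" by (rule poly_funs_compose[OF q g])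
  have degL: "degree_in_le i M (\<lambda>x. L a (\<lambda>b. g b x))" if "a \<in> W" for a i
    unfolding L_def M_def k_def
  proof (rule degree_in_le_prod)
    fix b assume b: "b \<in> B"
    then have "a b \<in> {..N}" using that by (auto simp: W_def)
    then have N: "card ({..N} - {a b}) = N" by simp
    have "degree_in_le i d (\<lambda>x. g b x - real c)" for c
      using degree_in_le_add[OF d[OF b] degree_in_le_const[of i d "- real c"]] by simp
    then show "degree_in_le i (N * d) (\<lambda>x. \<Prod>c\<in>{..N} - {a b}. (g b x - real c))"
      using degree_in_le_prod[of "{..N} - {a b}" i d "\<lambda>c x. g b x - real c"] by (simp only: N)
  qed
  have "degree_in_le i M (\<lambda>x. q (\<lambda>b. g b x))" for i
    unfolding q_def
    using degree_in_le_mult[OF degree_in_le_const[of i 0] degL] by (intro degree_in_le_sum) auto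
  moreover have "q (\<lambda>b. g b x) = 0" if "\<And>i. i \<in> I \<Longrightarrow> x i \<in> real ` {..M}" for x
  proof -
    have "q (\<lambda>b. g b x) = q (\<lambda>b. g b (restrict x I))" by (rule poly_funs_cong[OF qg]) auto
    also have "\<dots> = 0" unfolding q_def using that by (intro u) (auto simp: X_def)
    finally show ?thesis .
  qed
  ultimately have "q (\<lambda>b. g b x) = 0" for x
    using degree_in_le_zero_on_grid[OF fin(1), of M "\<lambda>x. q (\<lambda>b. g b x)"] by blast
  \<comment> \<open>Evaluation at the grid point \<open>a0\<close> isolates the nonzero coefficient
    \<open>u a0\<close>.\<close>
  then have "q (\<lambda>b. real (a0 b)) = 0" using indep q unfolding alg_independent_def by blast
  moreover have "L a (\<lambda>b. real (a0 b)) = 0" if a: "a \<in> W" "a \<noteq> a0" for a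
  proof -
    obtain b where "b \<in> B" "a b \<noteq> a0 b" 
      using a PiE_ext[of a B "\<lambda>_. {..N}" a0] a0(1) unfolding W_def by blast
    then have "a0 b \<in> {..N} - {a b}" using a0 by (auto simp: W_def)
    then have "(\<Prod>c\<in>{..N} - {a b}. (real (a0 b) - real c)) = 0"
      by (intro prod_zero bexI[of _ "a0 b"]) simp_all
    then show ?thesis using fin \<open>b \<in> B\<close> unfolding L_def
      by (intro prod_zero[OF fin(2)] bexI[of _ b])
  qed
  then have "q (\<lambda>b. real (a0 b)) = u a0 * L a0 (\<lambda>b. real (a0 b))"
    unfolding q_def using finW a0 by (subst sum.remove[of _ a0]) auto
  moreover have "L a0 (\<lambda>b. real (a0 b)) \<noteq> 0" unfolding L_def using fin by auto
  ultimately show False using a0 by simp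
qed

section \<open>Krull dimension of real affine space\<close>

lemma zariski_closed_subset: "zariski_closed I Z \<Longrightarrow> Z \<subseteq> I \<rightarrow>\<^sub>E UNIV"
  unfolding zariski_closed_def by auto

lemma zariski_closed_zero_set:
  "f \<in> poly_funs I \<Longrightarrow> zariski_closed I {x \<in> I \<rightarrow>\<^sub>E UNIV. f x = 0}"
  unfolding zariski_closed_def by (intro exI[of _ "{f}"]) auto

text \<open>The zero sets of \<open>f\<close> and \<open>g\<close> cover \<open>Z\<close>, so one of
  them contains it: the vanishing ideal is prime.\<close>

lemma zariski_irreducible_prime:
  assumes Z: "zariski_irreducible I Z" "Z \<subseteq> I \<rightarrow>\<^sub>E UNIV"
    and fg: "f \<in> poly_funs I" "g \<in> poly_funs I" "\<And>x. x \<in> Z \<Longrightarrow> f x * g x = 0"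
  shows "(\<forall>x\<in>Z. f x = 0) \<or> (\<forall>x\<in>Z. g x = 0)"
proof -
  let ?A = "{x \<in> I \<rightarrow>\<^sub>E UNIV. f x = 0}" and ?B = "{x \<in> I \<rightarrow>\<^sub>E UNIV. g x = 0}"
  have "Z \<subseteq> ?A \<union> ?B" using Z(2) fg(3) by fastforce
  moreover have "zariski_closed I ?A" "zariski_closed I ?B" using fg zariski_closed_zero_set by blast+
  ultimately have "Z \<subseteq> ?A \<or> Z \<subseteq> ?B" using Z(1) unfolding zariski_irreducible_def by meson
  then show ?thesis by blast
qed

text \<open>A point of \<open>Z\<close> outside \<open>A\<close> and one outside \<open>B\<close>
  are joined by a line inside \<open>Z\<close>, on which the two witnessing polynomials are
  somewhere nonzero together.\<close>

lemma zariski_irreducible_affine: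
  assumes ne: "Z \<noteq> {}" and sub: "Z \<subseteq> I \<rightarrow>\<^sub>E UNIV"
    and line: "\<And>x y s. x \<in> Z \<Longrightarrow> y \<in> Z \<Longrightarrow> restrict (\<lambda>i. x i + s * (y i - x i)) I \<in> Z"
  shows "zariski_irreducible I Z"
  unfolding zariski_irreducible_def
proof (intro conjI ne allI impI, rule ccontr)
  fix A B
  assume AB: "zariski_closed I A \<and> zariski_closed I B \<and> Z \<subseteq> A \<union> B" "\<not> (Z \<subseteq> A \<or> Z \<subseteq> B)"
  then obtain F G where F: "F \<subseteq> poly_funs I" "A = {x \<in> I \<rightarrow>\<^sub>E UNIV. \<forall>f\<in>F. f x = 0}"
    and G: "G \<subseteq> poly_funs I" "B = {x \<in> I \<rightarrow>\<^sub>E UNIV. \<forall>f\<in>G. f x = 0}"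
    unfolding zariski_closed_def by auto
  obtain x y where x: "x \<in> Z" "x \<notin> A" and y: "y \<in> Z" "y \<notin> B" using AB by auto
  then obtain f g where f: "f \<in> F" "f x \<noteq> 0" and g: "g \<in> G" "g y \<noteq> 0" using F G sub by auto
  have pf: "f \<in> poly_funs I" and pg: "g \<in> poly_funs I" using f g F G by auto
  obtain s where s: "f (\<lambda>i. x i + s * (y i - x i)) \<noteq> 0" "g (\<lambda>i. x i + s * (y i - x i)) \<noteq> 0"
    using poly_funs_common_nonzero_on_line[of f I x g y] pf f(2) pg g(2) by auto
  let ?z = "restrict (\<lambda>i. x i + s * (y i - x i)) I"
  have "f ?z \<noteq> 0" using s(1) poly_funs_cong[OF pf, of ?z "\<lambda>i. x i + s * (y i - x i)"] by simp
  moreover have "g ?z \<noteq> 0" using s(2) poly_funs_cong[OF pg, of ?z "\<lambda>i. x i + s * (y i - x i)"] by simp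
  moreover have "?z \<in> A \<union> B" using line[OF x(1) y(1)] AB by blast
  ultimately show False using F G f g by auto
qed

lemma zariski_closed_separating:
  assumes "zariski_closed I Z" "Z \<subset> Z'" "Z' \<subseteq> I \<rightarrow>\<^sub>E UNIV"
  shows "\<exists>f\<in>poly_funs I. (\<forall>x\<in>Z. f x = 0) \<and> (\<exists>x\<in>Z'. f x \<noteq> 0)"
proof -
  obtain F where F: "F \<subseteq> poly_funs I" "Z = {x \<in> I \<rightarrow>\<^sub>E UNIV. \<forall>f\<in>F. f x = 0}"
    using assms(1) unfolding zariski_closed_def by auto
  obtain x where x: "x \<in> Z'" "x \<notin> Z" using assms(2) by auto
  then obtain f where "f \<in> F" "f x \<noteq> 0" using F assms(3) by auto
  then show ?thesis using F x by blast
qed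

text \<open>The relation is only assumed on \<open>Z j\<close>, which lets the induction descend. On
  \<open>Z (Suc j)\<close> primality removes powers of \<open>f j\<close>, which is not identically
  zero there; on the smaller \<open>Z j\<close> the function \<open>f j\<close> vanishes, and what
  survives is a relation among the earlier ones.\<close>

lemma irreducible_chain_separating_independent:
  assumes irr: "\<And>i. i \<le> k \<Longrightarrow> zariski_irreducible I (Z i)" "\<And>i. i \<le> k \<Longrightarrow> Z i \<subseteq> I \<rightarrow>\<^sub>E UNIV"
    and sub: "\<And>i. i < k \<Longrightarrow> Z i \<subseteq> Z (Suc i)"
    and f: "\<And>i. i < k \<Longrightarrow> f i \<in> poly_funs I" "\<And>i x. i < k \<Longrightarrow> x \<in> Z i \<Longrightarrow> f i x = 0"
      "\<And>i. i < k \<Longrightarrow> \<exists>x\<in>Z (Suc i). f i x \<noteq> 0"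
    and q: "j \<le> k" "q \<in> poly_funs {..<j}" "\<And>x. x \<in> Z j \<Longrightarrow> q (\<lambda>i. f i x) = 0"
  shows "q y = 0"
  using q
proof (induction j arbitrary: q y)
  case 0
  obtain x where "x \<in> Z 0" using irr(1)[of 0] unfolding zariski_irreducible_def by auto
  then have "q (\<lambda>i. f i x) = 0" using 0 by auto
  moreover have "q (\<lambda>i. f i x) = q y" by (rule poly_funs_cong[OF 0(2)]) auto
  ultimately show ?case by simp
next
  case (Suc j)
  show ?case
  proof (rule ccontr)
    assume nz: "q y \<noteq> 0"
    have "q \<in> poly_funs (insert j {..<j})" using Suc.prems(2) by (simp add: lessThan_Suc)
    then obtain a d where a: "\<And>l. a l \<in> poly_funs {..<j}"
      "\<And>y. q y = (\<Sum>l\<le>d. a l y * y j ^ l)"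
      using poly_funs_insert_expand[of q j "{..<j}"] by auto
    have ex: "\<exists>l. l \<le> d \<and> (\<exists>y. a l y \<noteq> 0)"
    proof (rule ccontr)
      assume "\<not> ?thesis"
      then have "q y = 0" unfolding a(2) by (intro sum.neutral) auto
      then show False using nz by simp
    qed
    \<comment> \<open>The lowest occurring power, so that the cofactor of \<open>y j ^ e\<close> has
      constant term \<open>a e\<close> in \<open>y j\<close>.\<close>
    define e where "e = (LEAST l. l \<le> d \<and> (\<exists>y. a l y \<noteq> 0))"
    have e: "e \<le> d" "\<exists>y. a e y \<noteq> 0" using LeastI_ex[OF ex] unfolding e_def by auto
    have small: "a l y = 0" if "l < e" for l y
      using not_less_Least[of l "\<lambda>l. l \<le> d \<and> (\<exists>y. a l y \<noteq> 0)"] that e(1) unfolding e_def by auto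
    define r where "r y = (\<Sum>l\<in>{Suc e..d}. a l y * y j ^ (l - Suc e))" for y
    have qe: "q y = y j ^ e * (a e y + y j * r y)" for y
    proof -
      have "q y = (\<Sum>l\<in>{e..d}. a l y * y j ^ l)"
        unfolding a(2) using small by (intro sum.mono_neutral_right) auto
      also have "\<dots> = a e y * y j ^ e + (\<Sum>l\<in>{Suc e..d}. a l y * y j ^ l)"
        using e(1) by (rule sum.atLeast_Suc_atMost)
      also have "(\<Sum>l\<in>{Suc e..d}. a l y * y j ^ l) = y j ^ e * (y j * r y)"
        unfolding r_def sum_distrib_left
      proof (rule sum.cong[OF refl])
        fix l assume "l \<in> {Suc e..d}"
        then have "l = e + Suc (l - Suc e)" by simp
        then have "y j ^ l = y j ^ e * (y j * y j ^ (l - Suc e))" by (metis power_add power_Suc)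
        then show "a l y * y j ^ l = y j ^ e * (y j * (a l y * y j ^ (l - Suc e)))" by simp
      qed
      finally show ?thesis by (simp add: algebra_simps)
    qed
    have j: "j < k" using Suc.prems by simp
    have fj: "f i \<in> poly_funs I" if "i < Suc j" for i using f(1) that j by simp
    have aI: "(\<lambda>x. a l (\<lambda>i. f i x)) \<in> poly_funs I" for l
      by (rule poly_funs_compose[OF a(1)]) (use fj in auto)
    have P1: "(\<lambda>x. f j x ^ e) \<in> poly_funs I" using fj by (intro poly_funs_power) auto
    have P2: "(\<lambda>x. a e (\<lambda>i. f i x) + f j x * r (\<lambda>i. f i x)) \<in> poly_funs I"
      unfolding r_def using fj by (intro poly_funs.add poly_funs.mult poly_funs_sum poly_funs_power aI) auto
    have "f j x ^ e * (a e (\<lambda>i. f i x) + f j x * r (\<lambda>i. f i x)) = 0" if "x \<in> Z (Suc j)" for x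
      using Suc.prems(3)[OF that] unfolding qe .
    from zariski_irreducible_prime[OF irr(1)[OF Suc.prems(1)] irr(2)[OF Suc.prems(1)] P1 P2 this]
    have "\<forall>x\<in>Z (Suc j). a e (\<lambda>i. f i x) + f j x * r (\<lambda>i. f i x) = 0"
      using f(3)[OF j] by auto
    then have "a e (\<lambda>i. f i x) + f j x * r (\<lambda>i. f i x) = 0" if "x \<in> Z j" for x
      using sub[OF j] that by blast
    then have "a e (\<lambda>i. f i x) = 0" if "x \<in> Z j" for x
      using that by (metis f(2)[OF j] add_0_right mult_zero_left)
    then have "a e y = 0" for y using Suc.IH[OF _ a(1)] j by simp
    then show False using e(2) by simp
  qed
qed

lemma irreducible_chain_length:
  assumes fin: "finite I"
    and Z: "\<And>i. i \<le> k \<Longrightarrow> zariski_closed I (Z i) \<and> zariski_irreducible I (Z i)"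
      "\<And>i. i < k \<Longrightarrow> Z i \<subset> Z (Suc i)"
  shows "k \<le> card I"
proof -
  have "\<forall>i\<in>{..<k}. \<exists>f. f \<in> poly_funs I \<and> (\<forall>x\<in>Z i. f x = 0) \<and> (\<exists>x\<in>Z (Suc i). f x \<noteq> 0)"
  proof
    fix i assume "i \<in> {..<k}"
    then have "zariski_closed I (Z i)" "Z i \<subset> Z (Suc i)" "Z (Suc i) \<subseteq> I \<rightarrow>\<^sub>E UNIV"
      using Z zariski_closed_subset[of I "Z (Suc i)"] by auto
    from zariski_closed_separating[OF this]
    show "\<exists>f. f \<in> poly_funs I \<and> (\<forall>x\<in>Z i. f x = 0) \<and> (\<exists>x\<in>Z (Suc i). f x \<noteq> 0)" by blast
  qed
  from bchoice[OF this] obtain f where f: "\<And>i. i < k \<Longrightarrow> f i \<in> poly_funs I"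
    "\<And>i x. i < k \<Longrightarrow> x \<in> Z i \<Longrightarrow> f i x = 0" "\<And>i. i < k \<Longrightarrow> \<exists>x\<in>Z (Suc i). f i x \<noteq> 0"
    by auto
  have "alg_independent {..<k} f"
    unfolding alg_independent_def
  proof (intro ballI impI allI)
    fix q y assume q: "q \<in> poly_funs {..<k}" "\<forall>x. q (\<lambda>c. f c x) = 0"
    have Z': "zariski_irreducible I (Z i)" "Z i \<subseteq> I \<rightarrow>\<^sub>E UNIV" if "i \<le> k" for i
      using Z(1)[OF that] zariski_closed_subset by auto
    have sub: "Z i \<subseteq> Z (Suc i)" if "i < k" for i using Z(2)[OF that] by blast
    show "q y = 0"
      by (rule irreducible_chain_separating_independent
            [of k I Z f k q y, OF Z'(1) Z'(2) sub f(1) f(2) f(3) order_refl q(1)])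
         (use q(2) in simp_all)
  qed
  then have "card {..<k} \<le> card I" using fin f(1) by (intro alg_independent_card_le) auto
  then show ?thesis by simp
qed

text \<open>If a nonzero polynomial vanishes on \<open>S\<close>, every chain in the closure of
  \<open>S\<close> can be prolonged by the whole space and so stays one step short of the maximum.
  If \<open>S\<close> is dense, a flag of coordinate subspaces attains the maximum.\<close>

lemma alg_dim_eq_card_iff:
  assumes fin: "finite I" and S: "S \<noteq> {}" "S \<subseteq> I \<rightarrow>\<^sub>E UNIV"
  shows "alg_dim I S = enat (card I) \<longleftrightarrow>
    (\<forall>f\<in>poly_funs I. (\<forall>x\<in>S. f x = 0) \<longrightarrow> (\<forall>y. f y = 0))"
proof
  assume dim: "alg_dim I S = enat (card I)"
  show "\<forall>f\<in>poly_funs I. (\<forall>x\<in>S. f x = 0) \<longrightarrow> (\<forall>y. f y = 0)"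
  proof (intro ballI impI allI, rule ccontr)
    fix f y assume f: "f \<in> poly_funs I" "\<forall>x\<in>S. f x = 0" "f y \<noteq> 0"
    obtain x where x: "x \<in> S" using S(1) by auto
    \<comment> \<open>Without coordinates \<open>f\<close> would be constant. Positivity makes the
      natural-number difference \<open>card I - 1\<close> a genuine decrease.\<close>
    have "I \<noteq> {}" using f x poly_funs_cong[OF f(1), of x y] by auto
    then have pos: "card I > 0" using fin by auto
    let ?T = "I \<rightarrow>\<^sub>E (UNIV :: real set)"
    have y: "f (restrict y I) \<noteq> 0" using f(3) poly_funs_cong[OF f(1), of "restrict y I" y] by simp
    have "Suc k \<le> card I" if Z: "\<forall>i\<le>k. zariski_closed I (Z i) \<and> zariski_irreducible I (Z i) \<and>
        Z i \<subseteq> zariski_closed I hull S" "\<forall>i<k. Z i \<subset> Z (Suc i)" for k Z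
    proof (rule irreducible_chain_length[OF fin, of _ "\<lambda>i. if i \<le> k then Z i else ?T"])
      have "zariski_closed I ?T" unfolding zariski_closed_def by (intro exI[of _ "{}"]) auto
      moreover have "zariski_irreducible I ?T"
        by (rule zariski_irreducible_affine) (auto simp: PiE_eq_empty_iff)
      ultimately show "zariski_closed I (if i \<le> k then Z i else ?T) \<and>
          zariski_irreducible I (if i \<le> k then Z i else ?T)" for i using Z(1) by auto
      fix i assume i: "i < Suc k"
      show "(if i \<le> k then Z i else ?T) \<subset> (if Suc i \<le> k then Z (Suc i) else ?T)"
      proof (cases "i = k")
        case True
        have "Z k \<subseteq> ?T" using Z(1) zariski_closed_subset[of I "Z k"] by auto
        moreover have "restrict y I \<notin> Z k"
        proof
          assume "restrict y I \<in> Z k"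
          then have mem: "restrict y I \<in> zariski_closed I hull S" using Z(1) by auto
          have "zariski_closed I hull S \<subseteq> {x \<in> ?T. f x = 0}"
            using f S(2) by (intro hull_minimal zariski_closed_zero_set) auto
          then show False using mem y by auto
        qed
        ultimately show ?thesis using True by auto
      qed (use Z(2) i in auto)
    qed
    note len = this
    have "alg_dim I S \<le> enat (card I - 1)"
      unfolding alg_dim_def
    proof (rule Sup_least, elim CollectE exE conjE)
      fix v k Z
      assume v: "v = enat k" and Z: "\<forall>i\<le>k. zariski_closed I (Z i) \<and> zariski_irreducible I (Z i) \<and>
        Z i \<subseteq> zariski_closed I hull S" "\<forall>i<k. Z i \<subset> Z (Suc i)"
      show "v \<le> enat (card I - 1)" using len[OF Z] v by simp
    qed
    then show False using dim pos by simp
  qed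
next
  assume dense: "\<forall>f\<in>poly_funs I. (\<forall>x\<in>S. f x = 0) \<longrightarrow> (\<forall>y. f y = 0)"
  let ?T = "I \<rightarrow>\<^sub>E (UNIV :: real set)"
  have hull: "?T \<subseteq> zariski_closed I hull S"
    unfolding hull_def
  proof (rule Inter_greatest)
    fix T assume "T \<in> {t. zariski_closed I t \<and> S \<subseteq> t}"
    then obtain F where "F \<subseteq> poly_funs I" "T = {x \<in> ?T. \<forall>f\<in>F. f x = 0}" "S \<subseteq> T"
      unfolding zariski_closed_def by auto
    then show "?T \<subseteq> T" using dense by fastforce
  qed
  show "alg_dim I S = enat (card I)"
  proof (rule antisym)
    show "alg_dim I S \<le> enat (card I)"
      unfolding alg_dim_def
    proof (rule Sup_least, elim CollectE exE conjE)
      fix v k Z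
      assume v: "v = enat k" and Z: "\<forall>i\<le>k. zariski_closed I (Z i) \<and> zariski_irreducible I (Z i) \<and>
        Z i \<subseteq> zariski_closed I hull S" "\<forall>i<k. Z i \<subset> Z (Suc i)"
      show "v \<le> enat (card I)" using irreducible_chain_length[OF fin, of k Z] Z v by simp
    qed
    obtain b where b: "bij_betw b {0..<card I} I" using ex_bij_betw_nat_finite[OF fin] by auto
    \<comment> \<open>The first \<open>j\<close> coordinates are free: \<open>Z 0\<close> is the
      origin and \<open>Z (card I)\<close> the whole space.\<close>
    define Z where "Z j = {x \<in> ?T. \<forall>l\<in>{j..<card I}. x (b l) = 0}" for j
    have bI: "b l \<in> I" if "l < card I" for l using b that by (auto simp: bij_betw_def)
    have "zariski_closed I (Z j)" for j
      unfolding zariski_closed_def Z_def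
      by (intro exI[of _ "(\<lambda>l x. x (b l)) ` {j..<card I}"]) (auto intro!: poly_funs.coord bI)
    moreover have "zariski_irreducible I (Z j)" for j
    proof (rule zariski_irreducible_affine)
      have "restrict (\<lambda>_. 0) I \<in> Z j" unfolding Z_def using bI by auto
      then show "Z j \<noteq> {}" by auto
    qed (use bI in \<open>auto simp: Z_def\<close>)
    moreover have "Z j \<subseteq> zariski_closed I hull S" for j using hull by (auto simp: Z_def)
    moreover have "Z j \<subset> Z (Suc j)" if j: "j < card I" for j
    proof
      show "Z j \<subseteq> Z (Suc j)" by (auto simp: Z_def)
      let ?e = "restrict (\<lambda>i. if i = b j then 1 else 0) I :: _ \<Rightarrow> real"
      have "b l \<noteq> b j" if "l \<in> {Suc j..<card I}" for l
        using b that j unfolding bij_betw_def inj_on_def by fastforce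
      then have "?e \<in> Z (Suc j)" using bI by (auto simp: Z_def)
      moreover have "?e \<notin> Z j" using bI[OF j] j by (auto simp: Z_def)
      ultimately show "Z j \<noteq> Z (Suc j)" by blast
    qed
    ultimately show "enat (card I) \<le> alg_dim I S"
      unfolding alg_dim_def by (intro Sup_upper) blast
  qed
qed

section \<open>The Jacobian criterion\<close>

text \<open>In characteristic zero the derivative of a relation of minimal degree for \<open>x i\<close> over the \<open>G b\<close> does not
  vanish identically. Where it does not vanish, a direction in which all \<open>G b\<close> are stationary has zero
  \<open>i\<close>-th component.\<close>

lemma algebraic_coordinate_stationary:
  fixes G :: "'b \<Rightarrow> ('x \<Rightarrow> real) \<Rightarrow> real"
  assumes indep: "alg_independent B G" and G: "\<And>b. b \<in> B \<Longrightarrow> G b \<in> poly_funs X" and i: "i \<in> X"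
    and q: "q \<in> poly_funs (insert b0 B)" "\<And>x. q ((\<lambda>b. G b x)(b0 := x i)) = 0" "q z \<noteq> 0" and b0: "b0 \<notin> B"
  shows "\<exists>h\<in>poly_funs X. (\<exists>x. h x \<noteq> 0) \<and> (\<forall>x w.
    (\<forall>b\<in>B. ((\<lambda>s. G b (\<lambda>i. x i + s * w i)) has_real_derivative 0) (at 0)) \<longrightarrow> h x * w i = 0)"
proof -
  \<comment> \<open>Relations for \<open>x i\<close> of exact degree \<open>d\<close> over the
    \<open>G b\<close>; nonvanishing of the leading coefficient makes minimality of \<open>d\<close>
    meaningful.\<close>
  define R where "R d a \<longleftrightarrow> (\<forall>l. a l \<in> poly_funs B) \<and> (\<exists>y. a d y \<noteq> 0) \<and>
    (\<forall>x. (\<Sum>l\<le>d. a l (\<lambda>b. G b x) * x i ^ l) = 0)" for d and a :: "nat \<Rightarrow> ('b \<Rightarrow> real) \<Rightarrow> real"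
  obtain a0 d0 where a0: "\<And>l. a0 l \<in> poly_funs B" "\<And>y. q y = (\<Sum>l\<le>d0. a0 l y * y b0 ^ l)"
    "\<exists>y. a0 d0 y \<noteq> 0"
    using poly_funs_insert_expand_nonzero[OF q(1,3)] by blast
  have "R d0 a0"
    unfolding R_def
  proof (intro conjI allI a0)
    fix x
    have "a0 l ((\<lambda>b. G b x)(b0 := x i)) = a0 l (\<lambda>b. G b x)" for l
      by (rule poly_funs_cong[OF a0(1)]) (use b0 in auto)
    then show "(\<Sum>l\<le>d0. a0 l (\<lambda>b. G b x) * x i ^ l) = 0" using q(2)[of x] unfolding a0(2) by simp
  qed
  then have ex: "\<exists>d a. R d a" by blast
  define d where "d = (LEAST d. \<exists>a. R d a)"
  obtain a where R: "R d a" using LeastI_ex[OF ex] unfolding d_def by auto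
  have min: "\<not> R e b" if "e < d" for e b using not_less_Least[of e "\<lambda>d. \<exists>a. R d a"] that unfolding d_def by auto
  have "d \<noteq> 0"
  proof
    assume "d = 0"
    then have "\<forall>x. a 0 (\<lambda>b. G b x) = 0" "a 0 \<in> poly_funs B" "\<exists>y. a 0 y \<noteq> 0"
      using R unfolding R_def by auto
    then show False using indep unfolding alg_independent_def by blast
  qed
  then obtain e where e: "d = Suc e" by (cases d) auto
  \<comment> \<open>The derivative of the relation with respect to \<open>x i\<close>, the
    \<open>G b\<close> held fixed.\<close>
  define h where "h x = (\<Sum>l\<le>e. real (Suc l) * a (Suc l) (\<lambda>b. G b x) * x i ^ l)" for x
  have a: "a l \<in> poly_funs B" for l using R unfolding R_def by blast
  have aX: "(\<lambda>x. a l (\<lambda>b. G b x)) \<in> poly_funs X" for l by (rule poly_funs_compose[OF a G])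
  show ?thesis
  proof (intro bexI[of _ h] conjI allI impI)
    show "h \<in> poly_funs X" unfolding h_def using i
      by (intro poly_funs_sum poly_funs.mult poly_funs.const poly_funs_power poly_funs.coord aX)
    show "\<exists>x. h x \<noteq> 0"
    proof (rule ccontr)
      assume "\<nexists>x. h x \<noteq> 0"
      \<comment> \<open>The new leading coefficient is \<open>real (Suc e)\<close> times the old
        one, hence nonzero: this is where characteristic zero enters.\<close>
      then have "R e (\<lambda>l y. real (Suc l) * a (Suc l) y)"
        using R unfolding R_def e h_def by (auto intro: poly_funs.mult poly_funs.const a)
      then show False using min e by blast
    qed
    fix x w assume st: "\<forall>b\<in>B. ((\<lambda>s. G b (\<lambda>i. x i + s * w i)) has_real_derivative 0) (at 0)"
    let ?A = "\<lambda>l s. a l (\<lambda>b. G b (\<lambda>i. x i + s * w i))"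
    have A: "(?A l has_real_derivative 0) (at 0)" for l
      by (rule poly_funs_stationary[OF a]) (use st in auto)
    have "((\<lambda>s. ?A l s * (x i + s * w i) ^ l) has_real_derivative
        ?A l 0 * (real l * x i ^ (l - 1) * w i)) (at 0)" for l
      by (auto intro!: derivative_eq_intros A)
    then have "((\<lambda>s. \<Sum>l\<le>d. ?A l s * (x i + s * w i) ^ l) has_real_derivative
        (\<Sum>l\<le>d. ?A l 0 * (real l * x i ^ (l - 1) * w i))) (at 0)"
      by (intro DERIV_sum) auto
    moreover have "(\<lambda>s. \<Sum>l\<le>d. ?A l s * (x i + s * w i) ^ l) = (\<lambda>_. 0)"
      using R unfolding R_def by (intro ext) blast
    ultimately have "((\<lambda>_. 0) has_real_derivative
        (\<Sum>l\<le>d. ?A l 0 * (real l * x i ^ (l - 1) * w i))) (at (0::real))" by simp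
    from DERIV_unique[OF this DERIV_const]
    have "(\<Sum>l\<le>d. ?A l 0 * (real l * x i ^ (l - 1) * w i)) = 0" .
    \<comment> \<open>The term \<open>l = 0\<close> carries the factor \<open>real 0\<close>;
      shifting the index leaves \<open>h x * w i\<close>.\<close>
    then show "h x * w i = 0"
      unfolding h_def e sum_distrib_right sum.atMost_Suc_shift by (simp add: mult_ac)
  qed
qed

text \<open>The conclusion says that the differentials of the \<open>F c\<close> are linearly
  independent wherever \<open>H\<close> is nonzero. A maximal \<open>J\<close> completes
  \<open>F\<close> by coordinates to a transcendence basis. Each remaining coordinate is algebraic
  over it and contributes a factor \<open>h i\<close>, so where \<open>H\<close> is nonzero no
  nonzero direction is stationary for the whole basis.\<close>

lemma jacobian_criterion:
  fixes F :: "'c \<Rightarrow> ('x \<Rightarrow> real) \<Rightarrow> real"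
  assumes fin: "finite X" "finite C" and F: "\<And>c. c \<in> C \<Longrightarrow> F c \<in> poly_funs X"
    and indep: "alg_independent C F"
  obtains H where "H \<in> poly_funs X" "\<exists>x. H x \<noteq> 0"
    "\<And>x u c. H x \<noteq> 0 \<Longrightarrow> c \<in> C \<Longrightarrow>
       (\<And>w. ((\<lambda>s. \<Sum>c\<in>C. u c * F c (\<lambda>i. x i + s * w i)) has_real_derivative 0) (at 0)) \<Longrightarrow> u c = 0"
proof -
  define G :: "'c + 'x \<Rightarrow> ('x \<Rightarrow> real) \<Rightarrow> real"
    where "G b x = (case b of Inl c \<Rightarrow> F c x | Inr i \<Rightarrow> x i)" for b x
  define \<J> where "\<J> = {J. J \<subseteq> X \<and> alg_independent (C <+> J) G}"
  have "{} \<in> \<J>"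
    unfolding \<J>_def alg_independent_def
  proof (intro CollectI conjI ballI impI allI)
    fix q and y :: "'c + 'x \<Rightarrow> real"
    assume q: "q \<in> poly_funs (C <+> {})" "\<forall>x. q (\<lambda>b. G b x) = 0"
    let ?q = "\<lambda>y. q (\<lambda>b. case b of Inl c \<Rightarrow> y c | Inr i \<Rightarrow> 0)"
    have q': "?q \<in> poly_funs C" by (rule poly_funs_compose[OF q(1)]) (auto intro: poly_funs.coord)
    have "?q (\<lambda>c. F c x) = 0" for x
    proof -
      have "?q (\<lambda>c. F c x) = q (\<lambda>b. G b x)" by (rule poly_funs_cong[OF q(1)]) (auto simp: G_def)
      then show ?thesis using q(2) by simp
    qed
    then have "?q (\<lambda>c. y (Inl c)) = 0" by (rule alg_independentD[OF indep q'])
    moreover have "?q (\<lambda>c. y (Inl c)) = q y" by (rule poly_funs_cong[OF q(1)]) auto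
    ultimately show "q y = 0" by simp
  qed auto
  moreover have "finite \<J>" using fin(1) by (auto simp: \<J>_def intro: finite_subset[of _ "Pow X"])
  ultimately obtain J where J: "J \<in> \<J>" and Jmax: "\<And>J'. J' \<in> \<J> \<Longrightarrow> J \<subseteq> J' \<Longrightarrow> J = J'"
    using finite_has_maximal[of \<J>] by auto
  have JX: "J \<subseteq> X" and Ji: "alg_independent (C <+> J) G" using J by (auto simp: \<J>_def)
  have finJ: "finite J" using JX fin finite_subset by blast
  have G: "G b \<in> poly_funs X" if "b \<in> C <+> J" for b
    using that JX F by (auto simp: G_def[abs_def] intro!: poly_funs.coord)
  have "card (C <+> J) \<le> card X"
    by (rule alg_independent_card_le[OF _ _ G Ji]) (use fin finJ in auto)
  then have card: "card C + card J \<le> card X" using fin finJ by (simp add: card_Plus)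
  define Q where "Q i h \<longleftrightarrow> h \<in> poly_funs X \<and> (\<exists>x. h x \<noteq> 0) \<and> (\<forall>x w.
    (\<forall>b\<in>C <+> J. ((\<lambda>s. G b (\<lambda>i. x i + s * w i)) has_real_derivative 0) (at 0)) \<longrightarrow> h x * w i = 0)"
    for i h
  have "\<forall>i\<in>X - J. \<exists>h. Q i h"
  proof
    fix i assume i: "i \<in> X - J"
    have "insert i J \<notin> \<J>" using Jmax[of "insert i J"] i by auto
    then have "\<not> alg_independent (C <+> insert i J) G" using i JX by (auto simp: \<J>_def)
    then obtain q z where q: "q \<in> poly_funs (C <+> insert i J)" "\<And>x. q (\<lambda>b. G b x) = 0" "q z \<noteq> 0"
      unfolding alg_independent_def by auto
    have eq: "C <+> insert i J = insert (Inr i) (C <+> J)" by auto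
    have eq': "(\<lambda>b. G b x)(Inr i := x i) = (\<lambda>b. G b x)" for x by (auto simp: G_def)
    have "\<exists>h\<in>poly_funs X. (\<exists>x. h x \<noteq> 0) \<and> (\<forall>x w.
        (\<forall>b\<in>C <+> J. ((\<lambda>s. G b (\<lambda>i. x i + s * w i)) has_real_derivative 0) (at 0)) \<longrightarrow> h x * w i = 0)"
      by (rule algebraic_coordinate_stationary[OF Ji G, of i q "Inr i" z]) (use i q eq eq' in \<open>simp_all add: Plus_def image_iff\<close>)
    then show "\<exists>h. Q i h" unfolding Q_def by blast
  qed
  from bchoice[OF this] obtain h where hQ: "\<And>i. i \<in> X - J \<Longrightarrow> Q i (h i)" by blast
  have h: "h i \<in> poly_funs X" "\<exists>x. h i x \<noteq> 0"
    "\<And>x w. (\<And>b. b \<in> C <+> J \<Longrightarrow> ((\<lambda>s. G b (\<lambda>i. x i + s * w i)) has_real_derivative 0) (at 0))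
       \<Longrightarrow> h i x * w i = 0" if "i \<in> X - J" for i
    using hQ[OF that] unfolding Q_def by (blast, blast, blast)
  show ?thesis
  proof (rule that[of "\<lambda>x. \<Prod>i\<in>X - J. h i x"])
    show "(\<lambda>x. \<Prod>i\<in>X - J. h i x) \<in> poly_funs X" by (intro poly_funs_prod h(1))
    show "\<exists>x. (\<Prod>i\<in>X - J. h i x) \<noteq> 0"
      by (rule poly_funs_prod_nonzero[where I = X]) (use fin h in auto)
  next
    fix x u c0
    assume Hx: "(\<Prod>i\<in>X - J. h i x) \<noteq> 0" and c0: "c0 \<in> C"
      and u: "\<And>w. ((\<lambda>s. \<Sum>c\<in>C. u c * F c (\<lambda>i. x i + s * w i)) has_real_derivative 0) (at 0)"
    show "u c0 = 0"
    proof (rule ccontr)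
      assume nz: "u c0 \<noteq> 0"
      have "\<forall>c\<in>C. \<exists>D. \<forall>w. ((\<lambda>s. F c (\<lambda>i. x i + s * w i)) has_real_derivative (\<Sum>i\<in>X. w i * D i)) (at 0)"
        using poly_funs_gradient[OF F fin(1)] by blast
      from bchoice[OF this] obtain D where
        D: "\<And>c w. c \<in> C \<Longrightarrow> ((\<lambda>s. F c (\<lambda>i. x i + s * w i)) has_real_derivative (\<Sum>i\<in>X. w i * D c i)) (at 0)"
        by blast
      \<comment> \<open>With \<open>c0\<close> dropped there are fewer equations than unknowns, so
        some nonzero \<open>w\<close> solves them. The relation \<open>u\<close>, having
        \<open>u c0 \<noteq> 0\<close>, then yields the dropped equation as well.\<close>
      let ?B = "(C - {c0}) <+> J"
      have "card ?B < card X" using card c0 fin finJ card_gt_0_iff[of C] by (auto simp: card_Plus)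
      then obtain w where w: "\<exists>i\<in>X. w i \<noteq> 0"
        "\<And>b. b \<in> ?B \<Longrightarrow> (\<Sum>i\<in>X. w i * (case b of Inl c \<Rightarrow> D c i | Inr j \<Rightarrow> of_bool (i = j))) = 0"
        using homogeneous_system_nontrivial[of ?B X
          "\<lambda>i b. case b of Inl c \<Rightarrow> D c i | Inr j \<Rightarrow> of_bool (i = j)"] fin finJ by auto
      have wC: "(\<Sum>i\<in>X. w i * D c i) = 0" if "c \<in> C" "c \<noteq> c0" for c
        using w(2)[of "Inl c"] that by auto
      have wJ: "w j = 0" if "j \<in> J" for j
      proof -
        have "(\<Sum>i\<in>X. w i * of_bool (i = j)) = 0" using w(2)[of "Inr j"] that by auto
        moreover have "(\<Sum>i\<in>X. w i * of_bool (i = j)) = w j"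
          using that JX fin by (subst sum.remove[of X j]) auto
        ultimately show ?thesis by simp
      qed
      have "((\<lambda>s. \<Sum>c\<in>C. u c * F c (\<lambda>i. x i + s * w i)) has_real_derivative
          (\<Sum>c\<in>C. u c * (\<Sum>i\<in>X. w i * D c i))) (at 0)"
        by (intro DERIV_sum DERIV_cmult D)
      from DERIV_unique[OF this u] have "(\<Sum>c\<in>C. u c * (\<Sum>i\<in>X. w i * D c i)) = 0" .
      moreover have "(\<Sum>c\<in>C. u c * (\<Sum>i\<in>X. w i * D c i)) = u c0 * (\<Sum>i\<in>X. w i * D c0 i)"
        using c0 fin wC by (subst sum.remove[of C c0]) auto
      ultimately have "(\<Sum>i\<in>X. w i * D c0 i) = 0" using nz by simp
      then have wC': "(\<Sum>i\<in>X. w i * D c i) = 0" if "c \<in> C" for c using wC that by blast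
      have "((\<lambda>s. G b (\<lambda>i. x i + s * w i)) has_real_derivative 0) (at 0)" if "b \<in> C <+> J" for b
        using that
      proof (elim PlusE)
        fix c assume "c \<in> C" "b = Inl c"
        then show ?thesis using D[of c w] wC'[of c] by (simp add: G_def)
      next
        fix j assume "j \<in> J" "b = Inr j"
        then show ?thesis using wJ[of j] by (simp add: G_def)
      qed
      then have "h i x * w i = 0" if "i \<in> X - J" for i by (rule h(3)[OF that])
      then have "w i = 0" if "i \<in> X" for i using that wJ Hx fin by auto
      then show False using w(1) by auto
    qed
  qed
qed

section \<open>Zero sets of polynomials are null sets\<close>

lemma poly_funs_measurable:
  assumes "f \<in> poly_funs I"
  shows "f \<in> borel_measurable (PiM I (\<lambda>_. lborel))"
  using assms
proof induction
  case (coord i)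
  then have "(\<lambda>x. x i) \<in> measurable (PiM I (\<lambda>_. lborel :: real measure)) lborel"
    by (rule measurable_component_singleton)
  then show ?case by simp
qed auto

text \<open>Fubini in the last coordinate: for almost all values of the others the leading
  coefficient is nonzero, which leaves finitely many roots.\<close>

lemma poly_funs_AE_nonzero:
  assumes "finite I" "f \<in> poly_funs I" "f y \<noteq> 0"
  shows "AE x in PiM I (\<lambda>_. lborel). f x \<noteq> 0"
  using assms
proof (induction I arbitrary: f y)
  case empty
  have "f x \<noteq> 0" for x using poly_funs_cong[OF empty(1), of x y] empty(2) by simp
  then show ?case by simp
next
  case (insert i I)
  interpret product_sigma_finite "\<lambda>_. lborel :: real measure" by standard
  obtain a d where a: "\<And>l. a l \<in> poly_funs I" "\<And>y. f y = (\<Sum>l\<le>d. a l y * y i ^ l)"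
    "\<exists>y. a d y \<noteq> 0"
    using poly_funs_insert_expand_nonzero[OF insert.prems] by blast
  have meas[measurable]: "f \<in> borel_measurable (PiM (insert i I) (\<lambda>_. lborel))"
    by (rule poly_funs_measurable) (use insert in auto)
  have "AE x in PiM I (\<lambda>_. lborel). a d x \<noteq> 0" using insert.IH a(1,3) by blast
  then have "AE x in PiM I (\<lambda>_. lborel). (\<integral>\<^sup>+ t. indicator {x. f x = 0} (x(i := t)) \<partial>lborel) = 0"
  proof eventually_elim
    case (elim x)
    define p where "p = (\<Sum>l\<le>d. monom (a l x) l)"
    have p: "f (x(i := t)) = poly p t" for t
    proof -
      have "a l (x(i := t)) = a l x" for l
        by (rule poly_funs_cong[OF a(1)]) (use insert in auto)
      then show ?thesis by (simp add: a(2) p_def poly_sum poly_monom)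
    qed
    have "coeff p d = a d x" by (simp add: p_def coeff_sum)
    then have "p \<noteq> 0" using elim by auto
    then have roots: "finite {t. poly p t = 0}" by (rule poly_roots_finite)
    then have "emeasure lborel {t. poly p t = 0} = 0"
      by (intro null_setsD1 finite_imp_null_set_lborel)
    moreover have "(\<integral>\<^sup>+ t. indicator {x. f x = 0} (x(i := t)) \<partial>lborel) =
        (\<integral>\<^sup>+ t. indicator {t. poly p t = 0} t \<partial>lborel)"
      by (rule nn_integral_cong) (auto simp: indicator_def p)
    moreover have "{t. poly p t = 0} \<in> sets lborel" using roots by (simp add: finite_imp_closed)
    ultimately show ?case by simp
  qed
  then have "(\<integral>\<^sup>+ x. (\<integral>\<^sup>+ t. indicator {x. f x = 0} (x(i := t)) \<partial>lborel) \<partial>PiM I (\<lambda>_. lborel)) = 0"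
    by (simp add: nn_integral_0_iff_AE cong: nn_integral_cong_AE)
  moreover have ind: "indicator {x. f x = 0} \<in> borel_measurable (PiM (insert i I) (\<lambda>_. lborel))"
    by measurable
  ultimately have "(\<integral>\<^sup>+ x. indicator {x. f x = 0} x \<partial>PiM (insert i I) (\<lambda>_. lborel)) = (0 :: ennreal)"
    using product_nn_integral_insert[OF insert.hyps ind] by simp
  then have "AE x in PiM (insert i I) (\<lambda>_. lborel). indicator {x. f x = 0} x = (0 :: ennreal)"
    using nn_integral_0_iff_AE[OF ind] by simp
  then show ?case by eventually_elim (auto simp: indicator_def split: if_splits)
qed

section \<open>Coordinates on the space of concentration matrices\<close>

text \<open>Total and symmetric in \<open>i\<close>, \<open>j\<close>; on non-edges the value falls
  outside \<open>coords\<close>. Arguments by entries thereby avoid the \<open>Min\<close> and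
  \<open>Max\<close> in \<open>phi\<close>.\<close>

definition entry_coord :: "nat \<Rightarrow> nat \<Rightarrow> nat + nat set" where
  "entry_coord i j = (if i = j then Inl i else Inr {i, j})"

lemma entry_coord_commute: "entry_coord i j = entry_coord j i"
  by (auto simp: entry_coord_def insert_commute)

lemma entry_coord_in_coords:
  assumes "i < m" "j < m"
  shows "entry_coord i j \<in> coords m E \<longleftrightarrow> i = j \<or> {i, j} \<in> E"
  using assms by (auto simp: entry_coord_def coords_def)

lemma coords_entry_coord:
  assumes "simple_graph m E" "c \<in> coords m E"
  obtains i j where "i < m" "j < m" "c = entry_coord i j"
proof (cases c)
  case (Inl i)
  then show ?thesis using assms that[of i i] by (auto simp: coords_def entry_coord_def)
next
  case (Inr e)
  then have "e \<in> E" using assms by (auto simp: coords_def)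
  then obtain i j where "i < m" "j < m" "i \<noteq> j" "e = {i, j}"
    using assms unfolding simple_graph_def by blast
  then show ?thesis using Inr that[of i j] by (auto simp: entry_coord_def)
qed

lemma simple_graph_finite: "simple_graph m E \<Longrightarrow> finite E"
  unfolding simple_graph_def by (rule finite_subset[of _ "Pow {..<m}"]) auto

lemma finite_coords: "simple_graph m E \<Longrightarrow> finite (coords m E)"
  by (simp add: coords_def simple_graph_finite)

lemma card_coords: "simple_graph m E \<Longrightarrow> card (coords m E) = card {..<m} + card E"
  unfolding coords_def by (simp add: card_Plus simple_graph_finite)

lemma sym_mats_entry:
  assumes "A \<in> sym_mats m" "i < m" "j < m"
  shows "A $$ (j, i) = A $$ (i, j)"
  using assms unfolding sym_mats_def by (metis (mono_tags, lifting) carrier_matD index_transpose_mat(1) mem_Collect_eq)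

lemma sym_mats_matI:
  assumes "\<And>i j. i < m \<Longrightarrow> j < m \<Longrightarrow> f i j = f j i"
  shows "mat m m (\<lambda>(i, j). f i j) \<in> sym_mats m"
  unfolding sym_mats_def using assms by (auto intro!: eq_matI)

lemma phi_entry_coord:
  assumes A: "A \<in> sym_mats m" and ij: "i < m" "j < m" "entry_coord i j \<in> coords m E"
  shows "phi m E A (entry_coord i j) = A $$ (i, j)"
proof (cases "i = j")
  case True
  then show ?thesis using ij by (simp add: phi_def entry_coord_def)
next
  case False
  then have "{Min {i, j}, Max {i, j}} = {i, j}" "Min {i, j} < Max {i, j}"
    by (auto simp: min_def max_def)
  then have "(Min {i, j}, Max {i, j}) = (i, j) \<or> (Min {i, j}, Max {i, j}) = (j, i)"
    by (auto simp: doubleton_eq_iff)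
  then show ?thesis using False ij sym_mats_entry[OF A ij(1,2)] by (auto simp: phi_def entry_coord_def)
qed

definition coord_mat :: "nat \<Rightarrow> nat set set \<Rightarrow> (nat + nat set \<Rightarrow> real) \<Rightarrow> real mat" where
  "coord_mat m E u = mat m m (\<lambda>(i, j).
     if entry_coord i j \<in> coords m E then u (entry_coord i j) else 0)"

lemma coord_mat_entry:
  "i < m \<Longrightarrow> j < m \<Longrightarrow> coord_mat m E u $$ (i, j) =
     (if entry_coord i j \<in> coords m E then u (entry_coord i j) else 0)"
  by (simp add: coord_mat_def)

lemma L_space_sym: "K \<in> L_space m E \<Longrightarrow> K \<in> sym_mats m"
  by (simp add: L_space_def)

lemma L_space_zero:
  "K \<in> L_space m E \<Longrightarrow> i < m \<Longrightarrow> j < m \<Longrightarrow> entry_coord i j \<notin> coords m E \<Longrightarrow> K $$ (i, j) = 0"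
  by (simp add: L_space_def entry_coord_in_coords)

lemma L_space_eq_0:
  assumes "simple_graph m E" "K \<in> L_space m E" "\<And>c. c \<in> coords m E \<Longrightarrow> phi m E K c = 0"
  shows "K = 0\<^sub>m m m"
proof -
  have "K $$ (i, j) = 0" if "i < m" "j < m" for i j
    using phi_entry_coord[OF L_space_sym[OF assms(2)] that] L_space_zero[OF assms(2) that] assms(3)
    by metis
  moreover have "K \<in> carrier_mat m m" using assms(2) by (simp add: L_space_def sym_mats_def)
  ultimately show ?thesis by (intro eq_matI) auto
qed

lemma coord_mat_L_space: "coord_mat m E u \<in> L_space m E"
  unfolding L_space_def
proof (intro CollectI conjI allI impI)
  show "coord_mat m E u \<in> sym_mats m" unfolding coord_mat_def
    by (rule sym_mats_matI) (simp add: entry_coord_commute)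
  show "coord_mat m E u $$ (i, j) = 0" if "i < m" "j < m" "i \<noteq> j \<and> {i, j} \<notin> E" for i j
    using that by (simp add: coord_mat_entry entry_coord_in_coords)
qed

lemma L_space_minus:
  assumes "K \<in> L_space m E" "K' \<in> L_space m E"
  shows "K - K' \<in> L_space m E"
  using assms unfolding L_space_def sym_mats_def
  by (auto simp: transpose_minus[of _ m m])

text \<open>The weight of a coordinate in the Frobenius product: 1 for a vertex, 2 for an edge,
  whose entry occurs twice in the matrix.\<close>

definition entry_mult :: "nat \<Rightarrow> nat + nat set \<Rightarrow> nat" where
  "entry_mult m c = card {z \<in> {..<m} \<times> {..<m}. entry_coord (fst z) (snd z) = c}"

lemma entry_mult_pos:
  assumes "simple_graph m E" "c \<in> coords m E"
  shows "entry_mult m c > 0"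
proof -
  obtain i j where "i < m" "j < m" "c = entry_coord i j" by (rule coords_entry_coord[OF assms])
  then have "(i, j) \<in> {z \<in> {..<m} \<times> {..<m}. entry_coord (fst z) (snd z) = c}" by simp
  then show ?thesis unfolding entry_mult_def by (auto simp: card_gt_0_iff)
qed

text \<open>\<open>K\<close> vanishes off the graph, so pairing with it sees only
  \<open>phi m E A\<close>; the entries are grouped by coordinate.\<close>

lemma frob_inner_L_space:
  assumes G: "simple_graph m E" and K: "K \<in> L_space m E" and A: "A \<in> sym_mats m"
  shows "frob_inner m K A = (\<Sum>c\<in>coords m E. phi m E K c * real (entry_mult m c) * phi m E A c)"
proof -
  let ?e = "\<lambda>z. entry_coord (fst z) (snd z)" and ?V = "{..<m} \<times> {..<m}"
  define U where "U = {z \<in> ?V. ?e z \<in> coords m E}"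
  define h where "h z = K $$ z * A $$ z" for z
  have hc: "h z = phi m E K c * phi m E A c" if "z \<in> ?V" "?e z = c" "c \<in> coords m E" for z c
    using that phi_entry_coord[OF L_space_sym[OF K], of "fst z" "snd z"]
      phi_entry_coord[OF A, of "fst z" "snd z"] by (auto simp: h_def)
  have "frob_inner m K A = (\<Sum>z\<in>?V. h z)"
    unfolding frob_inner_def h_def by (simp add: sum.cartesian_product case_prod_beta)
  also have "\<dots> = (\<Sum>z\<in>U. h z)"
  proof (intro sum.mono_neutral_right ballI)
    fix z assume "z \<in> ?V - U"
    then show "h z = 0" using L_space_zero[OF K, of "fst z" "snd z"] by (auto simp: U_def h_def)
  qed (auto simp: U_def)
  also have "\<dots> = (\<Sum>c\<in>coords m E. \<Sum>z\<in>{z \<in> U. ?e z = c}. h z)"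
    by (rule sum.group[symmetric]) (auto simp: U_def finite_coords[OF G])
  also have "\<dots> = (\<Sum>c\<in>coords m E. phi m E K c * real (entry_mult m c) * phi m E A c)"
  proof (rule sum.cong[OF refl])
    fix c assume c: "c \<in> coords m E"
    then have eq: "{z \<in> U. ?e z = c} = {z \<in> ?V. ?e z = c}" by (auto simp: U_def)
    have "(\<Sum>z\<in>{z \<in> U. ?e z = c}. h z) = (\<Sum>z\<in>{z \<in> ?V. ?e z = c}. phi m E K c * phi m E A c)"
      unfolding eq using hc c by (intro sum.cong) auto
    then show "(\<Sum>z\<in>{z \<in> U. ?e z = c}. h z) = phi m E K c * real (entry_mult m c) * phi m E A c"
      by (simp add: entry_mult_def)
  qed
  finally show ?thesis .
qed

section \<open>Existence of the score matching estimator\<close>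

text \<open>Data matrices are functions \<open>p\<close> of the index pair, \<open>mult_entry m p K\<close> has the entries of \<open>P * K\<close>,
  and \<open>lyapunov m n p K\<close> is \<open>S * K + K * S\<close> for \<open>S = P\<^sup>T * P\<close> and symmetric \<open>K\<close>.\<close>

definition mult_entry :: "nat \<Rightarrow> (nat \<times> nat \<Rightarrow> real) \<Rightarrow> real mat \<Rightarrow> nat \<times> nat \<Rightarrow> real" where
  "mult_entry m p K = (\<lambda>(k, j). \<Sum>i<m. p (k, i) * K $$ (i, j))"

definition gram :: "nat \<Rightarrow> nat \<Rightarrow> (nat \<times> nat \<Rightarrow> real) \<Rightarrow> real mat" where
  "gram m n p = mat m m (\<lambda>(i, j). \<Sum>k<n. p (k, i) * p (k, j))"

definition lyapunov :: "nat \<Rightarrow> nat \<Rightarrow> (nat \<times> nat \<Rightarrow> real) \<Rightarrow> real mat \<Rightarrow> real mat" where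
  "lyapunov m n p K = mat m m (\<lambda>(i, j).
     \<Sum>k<n. p (k, i) * mult_entry m p K (k, j) + mult_entry m p K (k, i) * p (k, j))"

definition regular :: "nat \<Rightarrow> nat set set \<Rightarrow> nat \<Rightarrow> (nat \<times> nat \<Rightarrow> real) \<Rightarrow> bool" where
  "regular m E n p \<longleftrightarrow>
     (\<forall>K\<in>L_space m E. (\<forall>k<n. \<forall>j<m. mult_entry m p K (k, j) = 0) \<longrightarrow> K = 0\<^sub>m m m)"

lemma gram_eq: "(mat n m p)\<^sup>T * mat n m p = gram m n p"
  by (rule eq_matI) (auto simp: gram_def scalar_prod_def lessThan_atLeast0 intro!: sum.cong)

lemma gram_sym: "gram m n p \<in> sym_mats m"
  unfolding gram_def by (rule sym_mats_matI) (simp add: mult.commute)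

lemma lyapunov_sym: "lyapunov m n p K \<in> sym_mats m"
  unfolding lyapunov_def by (rule sym_mats_matI) (simp add: add.commute mult.commute)

lemma lyapunov_eq:
  assumes K: "K \<in> sym_mats m"
  shows "K * (gram m n p)\<^sup>T + gram m n p * K\<^sup>T = lyapunov m n p K"
proof -
  have Kc: "K \<in> carrier_mat m m" and Kt: "K\<^sup>T = K" using K by (auto simp: sym_mats_def)
  have Gc: "gram m n p \<in> carrier_mat m m" and Gt: "(gram m n p)\<^sup>T = gram m n p"
    using gram_sym[of m n p] by (auto simp: sym_mats_def)
  have 1: "(gram m n p * K) $$ (i, j) = (\<Sum>k<n. p (k, i) * mult_entry m p K (k, j))"
    if "i < m" "j < m" for i j
  proof -
    have "(gram m n p * K) $$ (i, j) = (\<Sum>l<m. (\<Sum>k<n. p (k, i) * p (k, l)) * K $$ (l, j))"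
      using that Kc Gc by (auto simp: scalar_prod_def lessThan_atLeast0 gram_def intro!: sum.cong)
    also have "\<dots> = (\<Sum>k<n. \<Sum>l<m. p (k, i) * p (k, l) * K $$ (l, j))"
      unfolding sum_distrib_right by (rule sum.swap)
    finally show ?thesis by (simp add: mult_entry_def sum_distrib_left mult.assoc)
  qed
  have 2: "(K * gram m n p) $$ (i, j) = (\<Sum>k<n. mult_entry m p K (k, i) * p (k, j))"
    if "i < m" "j < m" for i j
  proof -
    have "(K * gram m n p) $$ (i, j) = (gram m n p * K)\<^sup>T $$ (i, j)"
      using transpose_mult[OF Gc Kc] Gt Kt by simp
    also have "\<dots> = (gram m n p * K) $$ (j, i)" using that Kc Gc by simp
    finally show ?thesis using 1[OF that(2,1)] by (simp add: mult.commute)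
  qed
  show ?thesis unfolding Gt Kt
    by (rule eq_matI) (use Kc Gc 1 2 in \<open>auto simp: lyapunov_def sum.distrib\<close>)
qed

lemma frob_inner_lyapunov:
  assumes K: "K \<in> sym_mats m"
  shows "frob_inner m K (lyapunov m n p K) = 2 * (\<Sum>k<n. \<Sum>j<m. (mult_entry m p K (k, j))\<^sup>2)"
proof -
  let ?y = "mult_entry m p K"
  have 1: "(\<Sum>i<m. \<Sum>j<m. K $$ (i, j) * (\<Sum>k<n. p (k, i) * ?y (k, j))) = (\<Sum>k<n. \<Sum>j<m. (?y (k, j))\<^sup>2)"
  proof -
    have "(\<Sum>i<m. \<Sum>j<m. K $$ (i, j) * (\<Sum>k<n. p (k, i) * ?y (k, j))) =
        (\<Sum>i<m. \<Sum>j<m. \<Sum>k<n. p (k, i) * K $$ (i, j) * ?y (k, j))"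
      by (simp add: sum_distrib_left mult_ac)
    also have "\<dots> = (\<Sum>i<m. \<Sum>k<n. \<Sum>j<m. p (k, i) * K $$ (i, j) * ?y (k, j))"
      by (intro sum.cong refl sum.swap)
    also have "\<dots> = (\<Sum>k<n. \<Sum>i<m. \<Sum>j<m. p (k, i) * K $$ (i, j) * ?y (k, j))" by (rule sum.swap)
    also have "\<dots> = (\<Sum>k<n. \<Sum>j<m. \<Sum>i<m. p (k, i) * K $$ (i, j) * ?y (k, j))"
      by (intro sum.cong refl sum.swap)
    also have "\<dots> = (\<Sum>k<n. \<Sum>j<m. (?y (k, j))\<^sup>2)"
      by (simp add: sum_distrib_right[symmetric] mult_entry_def power2_eq_square)
    finally show ?thesis .
  qed
  have "(\<Sum>i<m. \<Sum>j<m. K $$ (i, j) * (\<Sum>k<n. ?y (k, i) * p (k, j))) =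
      (\<Sum>j<m. \<Sum>i<m. K $$ (i, j) * (\<Sum>k<n. ?y (k, i) * p (k, j)))" by (rule sum.swap)
  also have "\<dots> = (\<Sum>j<m. \<Sum>i<m. K $$ (j, i) * (\<Sum>k<n. p (k, j) * ?y (k, i)))"
    using sym_mats_entry[OF K] by (intro sum.cong refl) (auto simp: mult.commute)
  finally have 2: "(\<Sum>i<m. \<Sum>j<m. K $$ (i, j) * (\<Sum>k<n. ?y (k, i) * p (k, j))) =
      (\<Sum>k<n. \<Sum>j<m. (?y (k, j))\<^sup>2)" using 1 by simp
  show ?thesis
    unfolding frob_inner_def using 1 2 by (simp add: lyapunov_def sum.distrib distrib_left)
qed

lemma lyapunov_kernel:
  assumes G: "simple_graph m E" and K: "K \<in> L_space m E"
    and 0: "\<And>c. c \<in> coords m E \<Longrightarrow> phi m E (lyapunov m n p K) c = 0"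
  shows "\<forall>k<n. \<forall>j<m. mult_entry m p K (k, j) = 0"
proof -
  have "frob_inner m K (lyapunov m n p K) = 0"
    unfolding frob_inner_L_space[OF G K lyapunov_sym] using 0 by simp
  then have "(\<Sum>k<n. \<Sum>j<m. (mult_entry m p K (k, j))\<^sup>2) = 0"
    using frob_inner_lyapunov[OF L_space_sym[OF K]] by simp
  then show ?thesis
    by (subst (asm) sum_nonneg_eq_0_iff; simp add: sum_nonneg sum_nonneg_eq_0_iff)
qed

text \<open>Both \<open>K\<close> and the result have coordinates in \<open>coords m E\<close>, so
  the linear system is square and \<open>lyapunov_kernel\<close> makes it injective. The lemma
  serves both the existence of the estimator and the submersion property.\<close>

lemma lyapunov_surj:
  assumes G: "simple_graph m E" and reg: "regular m E n p"
  shows "\<exists>K\<in>L_space m E. \<forall>c\<in>coords m E. phi m E (lyapunov m n p K) c = v c"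
proof -
  let ?C = "coords m E"
  define M where "M a b = phi m E (lyapunov m n p (coord_mat m E (\<lambda>c. of_bool (c = a)))) b" for a b
  note fin = finite_coords[OF G]
  have lin: "phi m E (lyapunov m n p (coord_mat m E u)) b = (\<Sum>a\<in>?C. u a * M a b)"
    if b: "b \<in> ?C" for u b
  proof -
    obtain i j where ij: "i < m" "j < m" "b = entry_coord i j" by (rule coords_entry_coord[OF G b])
    have ent: "coord_mat m E u $$ (i, j) =
        (\<Sum>a\<in>?C. u a * coord_mat m E (\<lambda>c. of_bool (c = a)) $$ (i, j))" if "i < m" "j < m" for i j
    proof (cases "entry_coord i j \<in> ?C")
      case True
      then have "(\<Sum>a\<in>?C. u a * of_bool (entry_coord i j = a)) = u (entry_coord i j)"
        using fin by (subst sum.remove[of _ "entry_coord i j"]) auto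
      then show ?thesis using that True by (simp add: coord_mat_entry)
    qed (use that in \<open>simp add: coord_mat_entry\<close>)
    have y: "mult_entry m p (coord_mat m E u) (k, j) =
        (\<Sum>a\<in>?C. u a * mult_entry m p (coord_mat m E (\<lambda>c. of_bool (c = a))) (k, j))" if "j < m" for k j
    proof -
      have "mult_entry m p (coord_mat m E u) (k, j) =
          (\<Sum>i<m. \<Sum>a\<in>?C. p (k, i) * (u a * coord_mat m E (\<lambda>c. of_bool (c = a)) $$ (i, j)))"
        unfolding mult_entry_def using that by (simp add: ent sum_distrib_left)
      also have "\<dots> = (\<Sum>a\<in>?C. \<Sum>i<m. p (k, i) * (u a * coord_mat m E (\<lambda>c. of_bool (c = a)) $$ (i, j)))"
        by (rule sum.swap)
      finally show ?thesis by (simp add: mult_entry_def sum_distrib_left mult_ac)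
    qed
    have "phi m E (lyapunov m n p (coord_mat m E u)) b = (\<Sum>k<n. \<Sum>a\<in>?C. u a *
        (p (k, i) * mult_entry m p (coord_mat m E (\<lambda>c. of_bool (c = a))) (k, j) +
         mult_entry m p (coord_mat m E (\<lambda>c. of_bool (c = a))) (k, i) * p (k, j)))"
      using ij b phi_entry_coord[OF lyapunov_sym, of i m j E n p]
      by (simp add: lyapunov_def y sum_distrib_left sum_distrib_right sum.distrib distrib_left mult_ac)
    also have "\<dots> = (\<Sum>a\<in>?C. \<Sum>k<n. u a *
        (p (k, i) * mult_entry m p (coord_mat m E (\<lambda>c. of_bool (c = a))) (k, j) +
         mult_entry m p (coord_mat m E (\<lambda>c. of_bool (c = a))) (k, i) * p (k, j)))" by (rule sum.swap)
    also have "\<dots> = (\<Sum>a\<in>?C. u a * M a b)"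
      using ij b phi_entry_coord[OF lyapunov_sym, of i m j E n p]
      by (simp add: M_def lyapunov_def sum_distrib_left distrib_left sum.distrib)
    finally show ?thesis .
  qed
  have "\<exists>u. \<forall>b\<in>?C. (\<Sum>a\<in>?C. u a * M a b) = v b"
  proof (rule injective_system_solvable[OF fin])
    fix u assume "\<And>b. b \<in> ?C \<Longrightarrow> (\<Sum>a\<in>?C. u a * M a b) = 0"
    then have "\<forall>k<n. \<forall>j<m. mult_entry m p (coord_mat m E u) (k, j) = 0"
      by (intro lyapunov_kernel[OF G coord_mat_L_space]) (simp add: lin)
    then have 0: "coord_mat m E u = 0\<^sub>m m m" using reg coord_mat_L_space unfolding regular_def by blast
    show "\<forall>a\<in>?C. u a = 0"
    proof
      fix a assume a: "a \<in> ?C"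
      obtain i j where ij: "i < m" "j < m" "a = entry_coord i j" by (rule coords_entry_coord[OF G a])
      then show "u a = 0" using coord_mat_entry[of i m j E u] a 0 by simp
    qed
  qed
  then obtain u where "\<forall>b\<in>?C. (\<Sum>a\<in>?C. u a * M a b) = v b" by blast
  then show ?thesis by (intro bexI[of _ "coord_mat m E u"] coord_mat_L_space) (simp add: lin)
qed

text \<open>Outside \<open>coords\<close> the projection and the identity are both zero, so the
  estimating equation amounts to one scalar equation per coordinate.\<close>

lemma half_proj_L_eq_one_iff:
  assumes G: "simple_graph m E" and A: "A \<in> sym_mats m"
  shows "(1/2) \<cdot>\<^sub>m proj_L m E A = 1\<^sub>m m \<longleftrightarrow> (\<forall>c\<in>coords m E. phi m E A c = 2 * phi m E (1\<^sub>m m) c)"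
proof -
  have one: "1\<^sub>m m \<in> sym_mats m" by (simp add: sym_mats_def)
  have ent: "((1/2) \<cdot>\<^sub>m proj_L m E A) $$ (i, j) =
      (if entry_coord i j \<in> coords m E then A $$ (i, j) / 2 else 0)" if "i < m" "j < m" for i j
    using that by (simp add: proj_L_eq[OF A] entry_coord_in_coords)
  show ?thesis
  proof
    assume eq: "(1/2) \<cdot>\<^sub>m proj_L m E A = 1\<^sub>m m"
    show "\<forall>c\<in>coords m E. phi m E A c = 2 * phi m E (1\<^sub>m m) c"
    proof
      fix c assume c: "c \<in> coords m E"
      obtain i j where ij: "i < m" "j < m" "c = entry_coord i j" by (rule coords_entry_coord[OF G c])
      have "A $$ (i, j) / 2 = 1\<^sub>m m $$ (i, j)" using ent[OF ij(1,2)] c ij unfolding eq by simp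
      then show "phi m E A c = 2 * phi m E (1\<^sub>m m) c"
        using c ij phi_entry_coord[OF A, of i j] phi_entry_coord[OF one, of i j] by simp
    qed
  next
    assume eq: "\<forall>c\<in>coords m E. phi m E A c = 2 * phi m E (1\<^sub>m m) c"
    show "(1/2) \<cdot>\<^sub>m proj_L m E A = 1\<^sub>m m"
    proof (rule eq_matI)
      fix i j assume "i < dim_row (1\<^sub>m m)" "j < dim_col (1\<^sub>m m)"
      then have ij: "i < m" "j < m" by auto
      show "((1/2) \<cdot>\<^sub>m proj_L m E A) $$ (i, j) = 1\<^sub>m m $$ (i, j)"
      proof (cases "entry_coord i j \<in> coords m E")
        case True
        then have "A $$ (i, j) = 2 * 1\<^sub>m m $$ (i, j)"
          using eq phi_entry_coord[OF A ij] phi_entry_coord[OF one ij] by auto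
        then show ?thesis using ent[OF ij] True by simp
      next
        case False
        then have "i \<noteq> j" using ij by (auto simp: entry_coord_in_coords)
        then show ?thesis using ent[OF ij] False ij by simp
      qed
    qed (simp_all add: proj_L_eq[OF A])
  qed
qed

lemma phi_lyapunov_minus:
  assumes G: "simple_graph m E" and c: "c \<in> coords m E"
    and K: "K \<in> carrier_mat m m" "K' \<in> carrier_mat m m"
  shows "phi m E (lyapunov m n p (K - K')) c = phi m E (lyapunov m n p K) c - phi m E (lyapunov m n p K') c"
proof -
  obtain i j where ij: "i < m" "j < m" "c = entry_coord i j" by (rule coords_entry_coord[OF G c])
  have diff: "mult_entry m p (K - K') (k, j) = mult_entry m p K (k, j) - mult_entry m p K' (k, j)"
    if "j < m" for k j
    using that K by (simp add: mult_entry_def right_diff_distrib sum_subtractf)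
  have "phi m E (lyapunov m n p X) c =
      (\<Sum>k<n. p (k, i) * mult_entry m p X (k, j) + mult_entry m p X (k, i) * p (k, j))" for X
    using ij c phi_entry_coord[OF lyapunov_sym, of i m j E n p X] by (simp add: lyapunov_def)
  then show ?thesis unfolding sum_subtractf[symmetric]
    by (simp only: sum_subtractf[symmetric] diff[OF ij(1)] diff[OF ij(2)]) (simp add: algebra_simps)
qed

lemma sme_exists_iff_regular:
  assumes G: "simple_graph m E"
  shows "sme_exists m E (mat n m p) \<longleftrightarrow> regular m E n p"
proof -
  define T where "T K \<longleftrightarrow> (\<forall>c\<in>coords m E. phi m E (lyapunov m n p K) c = 2 * phi m E (1\<^sub>m m) c)" for K
  have car: "K \<in> carrier_mat m m" if "K \<in> L_space m E" for K using that by (simp add: L_space_def sym_mats_def)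
  have "(K \<in> L_space m E \<and>
      (1/2) \<cdot>\<^sub>m proj_L m E (K * (gram m n p)\<^sup>T + gram m n p * K\<^sup>T) = 1\<^sub>m m) \<longleftrightarrow> K \<in> L_space m E \<and> T K" for K
    using lyapunov_eq[OF L_space_sym, of K m E n p] half_proj_L_eq_one_iff[OF G lyapunov_sym, of n p K]
    unfolding T_def by (cases "K \<in> L_space m E") simp_all
  then have "sme_exists m E (mat n m p) \<longleftrightarrow> (\<exists>!K. K \<in> L_space m E \<and> T K)"
    unfolding sme_exists_def Let_def gram_eq by simp
  also have "\<dots> \<longleftrightarrow> regular m E n p"
  proof
    assume "\<exists>!K. K \<in> L_space m E \<and> T K"
    then obtain K where K: "K \<in> L_space m E" "T K" and uniq: "\<And>K'. K' \<in> L_space m E \<Longrightarrow> T K' \<Longrightarrow> K' = K"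
      by blast
    show "regular m E n p"
      unfolding regular_def
    proof (intro ballI impI)
      fix K0 assume K0: "K0 \<in> L_space m E" "\<forall>k<n. \<forall>j<m. mult_entry m p K0 (k, j) = 0"
      have "lyapunov m n p K0 $$ (i, j) = 0" if "i < m" "j < m" for i j
        using K0(2) that by (simp add: lyapunov_def)
      then have "phi m E (lyapunov m n p K0) c = 0" if c: "c \<in> coords m E" for c
        using coords_entry_coord[OF G c] phi_entry_coord[OF lyapunov_sym, of _ m _ E n p K0] c by metis
      \<comment> \<open>A kernel element can be subtracted from the solution without affecting the
        equation, which uniqueness forbids unless it is zero.\<close>
      then have "T (K - K0)"
        using K(2) phi_lyapunov_minus[OF G _ car[OF K(1)] car[OF K0(1)]] unfolding T_def by simp
      then have eq: "K - K0 = K" using uniq L_space_minus[OF K(1) K0(1)] by blast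
      have "K0 $$ (i, j) = 0" if "i < m" "j < m" for i j
        using arg_cong[OF eq, of "\<lambda>A. A $$ (i, j)"] that car[OF K0(1)] by simp
      then show "K0 = 0\<^sub>m m m" using car[OF K0(1)] by (intro eq_matI) auto
    qed
  next
    assume reg: "regular m E n p"
    obtain K where K: "K \<in> L_space m E" "T K"
      using lyapunov_surj[OF G reg, of "\<lambda>c. 2 * phi m E (1\<^sub>m m) c"] unfolding T_def by blast
    show "\<exists>!K. K \<in> L_space m E \<and> T K"
    proof (intro ex1I[of _ K] conjI K)
      fix K' assume K': "K' \<in> L_space m E \<and> T K'"
      have "phi m E (lyapunov m n p (K' - K)) c = 0" if "c \<in> coords m E" for c
        using phi_lyapunov_minus[OF G that, of K' K] car K K' that unfolding T_def by simp
      then have "\<forall>k<n. \<forall>j<m. mult_entry m p (K' - K) (k, j) = 0"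
        using K K' by (intro lyapunov_kernel[OF G]) (auto intro: L_space_minus)
      then have eq: "K' - K = 0\<^sub>m m m" using reg K K' L_space_minus unfolding regular_def by blast
      have "K' $$ (i, j) = K $$ (i, j)" if "i < m" "j < m" for i j
        using arg_cong[OF eq, of "\<lambda>A. A $$ (i, j)"] that car[OF K(1)] by simp
      then show "K' = K" using car[of K'] car[of K] K K' by (intro eq_matI) auto
    qed
  qed
  finally show ?thesis .
qed

section \<open>Density of the projected Gram matrices at a regular point\<close>

text \<open>Moving \<open>P\<close> in the direction \<open>P * K\<close> changes
  \<open>P\<^sup>T * P\<close> by \<open>lyapunov\<close> at first order and by
  \<open>(P * K)\<^sup>T * (P * K)\<close> at second order. By \<open>lyapunov_surj\<close> these
  directions already reach every tangent value when \<open>P\<close> is regular.\<close>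

lemma phi_gram_line:
  assumes G: "simple_graph m E" and c: "c \<in> coords m E"
  shows "phi m E (gram m n (\<lambda>z. p z + s * mult_entry m p K z)) c = phi m E (gram m n p) c +
    s * (phi m E (lyapunov m n p K) c + s * phi m E (gram m n (mult_entry m p K)) c)"
proof -
  obtain i j where ij: "i < m" "j < m" "c = entry_coord i j" by (rule coords_entry_coord[OF G c])
  have gram: "phi m E (gram m n r) c = (\<Sum>k<n. r (k, i) * r (k, j))" for r
    using ij c phi_entry_coord[OF gram_sym, of i m j E n r] by (simp add: gram_def)
  have "phi m E (lyapunov m n p K) c =
      (\<Sum>k<n. p (k, i) * mult_entry m p K (k, j) + mult_entry m p K (k, i) * p (k, j))"
    using ij c phi_entry_coord[OF lyapunov_sym, of i m j E n p K] by (simp add: lyapunov_def)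
  then show ?thesis
    unfolding gram by (simp add: sum_distrib_left sum.distrib algebra_simps)
qed

text \<open>The lowest-order homogeneous part of \<open>g\<close> at \<open>phi (P\<^sup>T * P)\<close> vanishes on the image of the derivative
  of \<open>P \<mapsto> phi (P\<^sup>T * P)\<close>, which is everything.\<close>

lemma regular_imp_gram_dense:
  assumes G: "simple_graph m E" and reg: "regular m E n p"
    and g: "g \<in> poly_funs (coords m E)" and zero: "\<And>p. g (phi m E (gram m n p)) = 0"
  shows "g y = 0"
proof (rule ccontr)
  assume nz: "g y \<noteq> 0"
  let ?y0 = "phi m E (gram m n p)"
  obtain h d where h: "\<And>k. h k \<in> poly_funs (coords m E)"
    and g_eq: "\<And>s y. g (\<lambda>i. ?y0 i + s * y i) = (\<Sum>k\<le>d. h k y * s ^ k)"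
    using poly_funs_taylor[OF g, of ?y0] by auto
  have ex: "\<exists>k. k \<le> d \<and> (\<exists>y. h k y \<noteq> 0)"
  proof (rule ccontr)
    assume "\<not> ?thesis"
    then have "(\<Sum>k\<le>d. h k (\<lambda>c. y c - ?y0 c) * 1 ^ k) = 0" by (intro sum.neutral) auto
    then have "g (\<lambda>c. ?y0 c + 1 * (y c - ?y0 c)) = 0" unfolding g_eq .
    then show False using nz by simp
  qed
  define e where "e = (LEAST k. k \<le> d \<and> (\<exists>y. h k y \<noteq> 0))"
  have e: "e \<le> d" "\<exists>y. h e y \<noteq> 0" using LeastI_ex[OF ex] unfolding e_def by auto
  have small: "h k y = 0" if "k < e" for k y
    using not_less_Least[of k "\<lambda>k. k \<le> d \<and> (\<exists>y. h k y \<noteq> 0)"] that e(1) unfolding e_def by auto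
  obtain v where v: "h e v \<noteq> 0" using e(2) by auto
  obtain K where K: "\<And>c. c \<in> coords m E \<Longrightarrow> phi m E (lyapunov m n p K) c = v c"
    using lyapunov_surj[OF G reg, of v] by blast
  define z where "z = phi m E (gram m n (mult_entry m p K))"
  define r where "r s = (\<Sum>k\<in>{e..d}. h k (\<lambda>c. v c + s * z c) * s ^ (k - e))" for s
  have "s ^ e * r s = 0" for s
  proof -
    have "0 = g (phi m E (gram m n (\<lambda>z. p z + s * mult_entry m p K z)))" by (simp add: zero)
    \<comment> \<open>The second-order term is absorbed into the displacement
      \<open>v c + s * z c\<close>, which depends on \<open>s\<close>.\<close>
    also have "\<dots> = g (\<lambda>c. ?y0 c + s * (v c + s * z c))"
      by (rule poly_funs_cong[OF g]) (simp add: phi_gram_line[OF G] K z_def)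
    also have "\<dots> = (\<Sum>k\<le>d. h k (\<lambda>c. v c + s * z c) * s ^ k)" by (rule g_eq)
    also have "\<dots> = (\<Sum>k\<in>{e..d}. h k (\<lambda>c. v c + s * z c) * s ^ k)"
      using small by (intro sum.mono_neutral_right) auto
    also have "\<dots> = s ^ e * r s"
      unfolding r_def sum_distrib_left
      by (intro sum.cong refl) (auto simp: power_add[symmetric] mult_ac)
    finally show ?thesis by simp
  qed
  then have r0: "r s = 0" if "s \<noteq> 0" for s using that by (metis mult_eq_0_iff power_not_zero)
  have "\<exists>q. \<forall>s. h k (\<lambda>c. v c + s * z c) = poly q s" for k by (rule poly_funs_line[OF h])
  then obtain q where q: "\<And>k s. h k (\<lambda>c. v c + s * z c) = poly (q k) s" by metis
  \<comment> \<open>Dividing by \<open>s ^ e\<close> gives \<open>r s = 0\<close> only for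
    \<open>s \<noteq> 0\<close>; continuity carries this to 0, where just the term
    \<open>k = e\<close> survives.\<close>
  have "isCont r 0" unfolding r_def q by (intro continuous_intros)
  then have "(r \<longlongrightarrow> r 0) (at 0)" by (simp add: isCont_def)
  moreover have "(r \<longlongrightarrow> 0) (at 0)"
    by (rule tendsto_eventually) (auto simp: eventually_at_filter r0)
  ultimately have "r 0 = 0" using tendsto_unique trivial_limit_at by blast
  moreover have "r 0 = h e v"
  proof -
    have "r 0 = (\<Sum>k\<in>{e}. h k (\<lambda>c. v c + 0 * z c) * 0 ^ (k - e))"
      unfolding r_def using e(1) by (intro sum.mono_neutral_right) auto
    then show ?thesis by simp
  qed
  ultimately show False using v by simp
qed

section \<open>Parametrising symmetric matrices of bounded rank\<close>

text \<open>Each row of \<open>P\<close> adds a matrix of rank at most one.\<close>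

lemma gram_rank_le: "vec_space.rank m (gram m n p) \<le> n"
proof (induction n)
  case 0
  have "gram m 0 p = 0\<^sub>m m m" by (rule eq_matI) (auto simp: gram_def)
  then show ?case by (simp add: vec_space.rank_0I)
next
  case (Suc n)
  let ?R = "mat m m (\<lambda>(i, j). p (n, i) * p (n, j))"
  have "gram m (Suc n) p = gram m n p + ?R" by (rule eq_matI) (auto simp: gram_def)
  moreover have "vec_space.rank m (gram m n p + ?R) \<le> vec_space.rank m (gram m n p) + vec_space.rank m ?R"
    by (rule vec_space.rank_subadditive) (auto simp: gram_def)
  moreover have "vec_space.rank m ?R \<le> 1"
    by (rule vec_space.rank_le_1_product_entries[of _ _ _ "\<lambda>i. p (n, i)" "\<lambda>j. p (n, j)"]) auto
  ultimately show ?case using Suc by simp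
qed

lemma gram_sym_rank_le: "gram m n p \<in> sym_rank_le m n"
  by (simp add: sym_rank_le_def gram_sym gram_rank_le)

text \<open>A maximal independent set of columns spans all columns and has \<open>rank A\<close>
  elements; \<open>t\<close> lists their positions and \<open>r\<close> the coefficients.\<close>

lemma rank_le_columns_generate:
  fixes A :: "real mat"
  assumes A: "A \<in> carrier_mat m nc" and rank: "vec_space.rank m A \<le> n"
  shows "\<exists>r t. \<forall>j<nc. \<forall>i<m. A $$ (i, j) = (\<Sum>k<n. r k j * A $$ (i, t k)) \<and>
    (\<forall>k<n. t k < nc \<or> r k j = 0)"
proof -
  interpret vec_space "TYPE(real)" m .
  have cols: "set (cols A) \<subseteq> carrier_vec m" using A cols_dim by blast
  obtain S where S: "maximal S (\<lambda>T. T \<subseteq> set (cols A) \<and> lin_indpt T)"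
    using maximal_exists[of "(\<lambda>T. T \<subseteq> set (cols A) \<and> lin_indpt T)" "card (set (cols A))" "{}"]
    by (meson List.finite_set card_mono empty_iff empty_subsetI finite_lin_indpt2 rev_finite_subset)
  have SA: "S \<subseteq> set (cols A)" and Sli: "lin_indpt S" using S by (auto simp: maximal_def)
  have finS: "finite S" using SA finite_subset by blast
  have cardS: "card S \<le> n" using rank_card_indpt[OF A S] rank by simp
  have span: "v \<in> span S" if v: "v \<in> set (cols A)" for v
  proof (rule ccontr)
    assume nv: "v \<notin> span S"
    have Sc: "S \<subseteq> carrier_vec m" and vc: "v \<in> carrier_vec m" using SA cols v by auto
    have "v \<notin> S" using nv span_mem[OF Sc] by auto
    then have "lin_indpt (insert v S)" using lin_dep_iff_in_span[of S v] Sc Sli vc nv by auto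
    then have "insert v S = S" using S v SA unfolding maximal_def by blast
    then show False using \<open>v \<notin> S\<close> by auto
  qed
  have "\<exists>a. \<forall>i<m. A $$ (i, j) = (\<Sum>w\<in>S. a w * w $ i)" if "j < nc" for j
  proof -
    have "col A j \<in> set (cols A)" using that A by (simp add: cols_def)
    then have "col A j \<in> span S" by (rule span)
    moreover have "S \<subseteq> carrier_vec m" using SA cols by blast
    ultimately have "\<exists>a. lincomb a S = col A j" using finite_in_span[OF finS, of "col A j"] by simp
    then obtain a where a: "lincomb a S = col A j" by (elim exE)
    have "A $$ (i, j) = (\<Sum>w\<in>S. a w * w $ i)" if i: "i < m" for i
    proof -
      have "A $$ (i, j) = lincomb a S $ i" using a i \<open>j < nc\<close> A by simp
      also have "\<dots> = (\<Sum>w\<in>S. a w * w $ i)" by (rule lincomb_index[OF i]) (use SA cols in blast)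
      finally show ?thesis .
    qed
    then show ?thesis by blast
  qed
  then obtain a where a: "\<And>i j. i < m \<Longrightarrow> j < nc \<Longrightarrow> A $$ (i, j) = (\<Sum>w\<in>S. a j w * w $ i)" by metis
  have "set (cols A) = col A ` {0..<nc}" using A by (simp add: cols_def)
  then have "\<forall>w\<in>S. \<exists>l<nc. w = col A l" using SA by fastforce
  then obtain l where l: "\<And>w. w \<in> S \<Longrightarrow> l w < nc \<and> w = col A (l w)" by metis
  obtain b where b: "bij_betw b {0..<card S} S" using ex_bij_betw_nat_finite[OF finS] by auto
  define t where "t k = l (b k)" for k
  \<comment> \<open>Zero padding from \<open>card S\<close> up to \<open>n\<close>. There
    \<open>b k\<close> is unspecified and \<open>t k\<close> may be out of range, whence the
    disjunction in the statement.\<close>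
  define r where "r k j = (if k < card S then a j (b k) else 0)" for k j
  have bS: "b k \<in> S" if "k < card S" for k using b that by (auto simp: bij_betw_def)
  have "A $$ (i, j) = (\<Sum>k<n. r k j * A $$ (i, t k))" if "i < m" "j < nc" for i j
  proof -
    have "A $$ (i, j) = (\<Sum>w\<in>S. a j w * w $ i)" by (rule a[OF that])
    also have "\<dots> = (\<Sum>k\<in>{0..<card S}. a j (b k) * b k $ i)"
      by (rule sum.reindex_bij_betw[OF b, symmetric])
    also have "\<dots> = (\<Sum>k\<in>{0..<card S}. r k j * A $$ (i, t k))"
    proof (rule sum.cong[OF refl])
      fix k assume "k \<in> {0..<card S}"
      then have k: "k < card S" by simp
      have "b k $ i = col A (l (b k)) $ i" using l[OF bS[OF k]] by simp
      also have "\<dots> = A $$ (i, t k)" using conjunct1[OF l[OF bS[OF k]]] that A by (simp add: t_def)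
      finally show "a j (b k) * b k $ i = r k j * A $$ (i, t k)" using k by (simp add: r_def)
    qed
    also have "\<dots> = (\<Sum>k<n. r k j * A $$ (i, t k))"
      using cardS by (intro sum.mono_neutral_left) (auto simp: r_def)
    finally show ?thesis .
  qed
  moreover have "t k < nc \<or> r k j = 0" for k j using l bS by (auto simp: t_def r_def)
  ultimately show ?thesis by blast
qed

text \<open>The matrix \<open>P\<^sup>T * (M + M\<^sup>T) * P\<close>, where \<open>x\<close> lists the entries of \<open>P\<close> and \<open>M\<close>.\<close>

definition sym_param :: "nat \<Rightarrow> nat \<Rightarrow> (nat \<times> nat + nat \<times> nat \<Rightarrow> real) \<Rightarrow> real mat" where
  "sym_param m n x = mat m m (\<lambda>(i, j).
     \<Sum>k<n. \<Sum>l<n. x (Inl (k, i)) * (x (Inr (k, l)) + x (Inr (l, k))) * x (Inl (l, j)))"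

definition sym_param_vars :: "nat \<Rightarrow> nat \<Rightarrow> (nat \<times> nat + nat \<times> nat) set" where
  "sym_param_vars m n = ({..<n} \<times> {..<m}) <+> ({..<n} \<times> {..<n})"

lemma sym_param_sym: "sym_param m n x \<in> sym_mats m"
  unfolding sym_param_def
proof (rule sym_mats_matI)
  fix i j
  have "(\<Sum>k<n. \<Sum>l<n. x (Inl (k, i)) * (x (Inr (k, l)) + x (Inr (l, k))) * x (Inl (l, j))) =
      (\<Sum>l<n. \<Sum>k<n. x (Inl (k, i)) * (x (Inr (k, l)) + x (Inr (l, k))) * x (Inl (l, j)))"
    by (rule sum.swap)
  then show "(\<Sum>k<n. \<Sum>l<n. x (Inl (k, i)) * (x (Inr (k, l)) + x (Inr (l, k))) * x (Inl (l, j))) =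
      (\<Sum>k<n. \<Sum>l<n. x (Inl (k, j)) * (x (Inr (k, l)) + x (Inr (l, k))) * x (Inl (l, i)))"
    by (simp add: mult_ac add.commute)
qed

text \<open>If the columns \<open>t 0, \<dots>, t (n - 1)\<close> generate, so \<open>A = A\<^sub>t * R\<close>, then symmetry gives
  \<open>A = R\<^sup>T * A\<^sub>t\<^sub>t * R\<close> for the principal submatrix \<open>A\<^sub>t\<^sub>t\<close>.\<close>

lemma sym_rank_le_sym_param:
  assumes "A \<in> sym_rank_le m n"
  shows "\<exists>x. A = sym_param m n x"
proof -
  have A: "A \<in> sym_mats m" and rank: "vec_space.rank m A \<le> n" using assms by (auto simp: sym_rank_le_def)
  have Ac: "A \<in> carrier_mat m m" using A by (simp add: sym_mats_def)
  obtain r t where rt: "\<And>i j. i < m \<Longrightarrow> j < m \<Longrightarrow> A $$ (i, j) = (\<Sum>k<n. r k j * A $$ (i, t k))"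
    "\<And>k j. j < m \<Longrightarrow> k < n \<Longrightarrow> t k < m \<or> r k j = 0"
  proof -
    from rank_le_columns_generate[OF Ac rank] obtain r t where
      *: "\<forall>j<m. \<forall>i<m. A $$ (i, j) = (\<Sum>k<n. r k j * A $$ (i, t k)) \<and> (\<forall>k<n. t k < m \<or> r k j = 0)"
      by blast
    show ?thesis by (rule that[of r t]) (use * in blast)+
  qed
  \<comment> \<open>Halving makes \<open>M + M\<^sup>T\<close> the principal submatrix. Indices
    \<open>t k\<close> out of range do no harm, because \<open>r k\<close> is zero there.\<close>
  define x where "x = case_sum (\<lambda>(k, i). r k i) (\<lambda>(k, l). A $$ (t k, t l) / 2)"
  have "A $$ (i, j) = sym_param m n x $$ (i, j)" if ij: "i < m" "j < m" for i j
  proof -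
    have "A $$ (i, j) = (\<Sum>l<n. r l j * A $$ (i, t l))" by (rule rt(1)[OF ij])
    also have "\<dots> = (\<Sum>l<n. \<Sum>k<n. r k i * (A $$ (t k, t l) / 2 + A $$ (t l, t k) / 2) * r l j)"
    proof (rule sum.cong[OF refl])
      fix l assume "l \<in> {..<n}"
      then have l: "l < n" by simp
      show "r l j * A $$ (i, t l) = (\<Sum>k<n. r k i * (A $$ (t k, t l) / 2 + A $$ (t l, t k) / 2) * r l j)"
      proof (cases "r l j = 0")
        case False
        then have tl: "t l < m" using rt(2)[OF ij(2) l] by auto
        have "A $$ (i, t l) = (\<Sum>k<n. r k i * A $$ (t l, t k))"
          using sym_mats_entry[OF A tl ij(1)] rt(1)[OF tl ij(1)] by simp
        also have "\<dots> = (\<Sum>k<n. r k i * (A $$ (t k, t l) / 2 + A $$ (t l, t k) / 2))"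
        proof (rule sum.cong[OF refl])
          fix k assume "k \<in> {..<n}"
          then have "t k < m \<or> r k i = 0" using rt(2) ij by auto
          then show "r k i * A $$ (t l, t k) = r k i * (A $$ (t k, t l) / 2 + A $$ (t l, t k) / 2)"
            using sym_mats_entry[OF A tl, of "t k"] by auto
        qed
        finally show ?thesis by (simp add: sum_distrib_left mult.commute)
      qed simp
    qed
    also have "\<dots> = (\<Sum>k<n. \<Sum>l<n. r k i * (A $$ (t k, t l) / 2 + A $$ (t l, t k) / 2) * r l j)"
      by (rule sum.swap)
    finally show ?thesis using ij by (simp add: sym_param_def x_def)
  qed
  then have "A = sym_param m n x" using Ac by (intro eq_matI) (auto simp: sym_param_def)
  then show ?thesis by blast
qed

lemma phi_sym_param_poly_funs:
  assumes G: "simple_graph m E" and c: "c \<in> coords m E"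
  shows "(\<lambda>x. phi m E (sym_param m n x) c) \<in> poly_funs (sym_param_vars m n)"
proof -
  obtain i j where ij: "i < m" "j < m" "c = entry_coord i j" by (rule coords_entry_coord[OF G c])
  then have "(\<lambda>x. phi m E (sym_param m n x) c) = (\<lambda>x. \<Sum>k<n. \<Sum>l<n.
      x (Inl (k, i)) * (x (Inr (k, l)) + x (Inr (l, k))) * x (Inl (l, j)))"
    using c phi_entry_coord[OF sym_param_sym, of i m j E n] by (auto simp: sym_param_def)
  moreover have "\<dots> \<in> poly_funs (sym_param_vars m n)"
    using ij by (intro poly_funs_sum poly_funs.mult poly_funs.add poly_funs.coord)
      (auto simp: sym_param_vars_def)
  ultimately show ?thesis by simp
qed

text \<open>With \<open>P * K = 0\<close>, and \<open>K * P\<^sup>T = 0\<close> by symmetry, every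
  term still containing an undisturbed factor \<open>P\<close> drops out. The displacement of
  \<open>P\<close> survives only quadratically, and the middle factor is affine in
  \<open>s\<close>.\<close>

lemma frob_inner_sym_param_line:
  assumes K: "K \<in> sym_mats m"
    and ker: "\<And>k j. k < n \<Longrightarrow> j < m \<Longrightarrow> mult_entry m (\<lambda>z. x (Inl z)) K (k, j) = 0"
  shows "\<exists>a b. \<forall>s. frob_inner m K (sym_param m n (\<lambda>i. x i + s * w i)) = s\<^sup>2 * (a + s * b)"
proof -
  \<comment> \<open>The entries of \<open>W * K * W\<^sup>T\<close>, with \<open>W\<close> the
    displacement of \<open>P\<close>.\<close>
  define T where "T k l = (\<Sum>i<m. \<Sum>j<m. K $$ (i, j) * (w (Inl (k, i)) * w (Inl (l, j))))" for k l
  define M where "M x k l = x (Inr (k, l)) + x (Inr (l, k))" for x :: "nat \<times> nat + nat \<times> nat \<Rightarrow> real" and k l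
  have col: "(\<Sum>i<m. x (Inl (k, i)) * K $$ (i, j)) = 0" if "k < n" "j < m" for k j
    using ker[OF that] by (simp add: mult_entry_def)
  have row: "(\<Sum>j<m. K $$ (i, j) * x (Inl (l, j))) = 0" if "l < n" "i < m" for l i
  proof -
    have "(\<Sum>j<m. K $$ (i, j) * x (Inl (l, j))) = (\<Sum>j<m. x (Inl (l, j)) * K $$ (j, i))"
      using sym_mats_entry[OF K] that by (intro sum.cong) (auto simp: mult.commute)
    then show ?thesis using col[OF that] by simp
  qed
  have bil: "(\<Sum>i<m. \<Sum>j<m. K $$ (i, j) * ((x (Inl (k, i)) + s * w (Inl (k, i))) *
      (x (Inl (l, j)) + s * w (Inl (l, j))))) = s\<^sup>2 * T k l" if kl: "k < n" "l < n" for k l s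
  proof -
    have 1: "(\<Sum>i<m. \<Sum>j<m. K $$ (i, j) * (x (Inl (k, i)) * u j)) = 0" for u
    proof -
      have "(\<Sum>i<m. \<Sum>j<m. K $$ (i, j) * (x (Inl (k, i)) * u j)) =
          (\<Sum>j<m. \<Sum>i<m. K $$ (i, j) * (x (Inl (k, i)) * u j))" by (rule sum.swap)
      also have "\<dots> = (\<Sum>j<m. (\<Sum>i<m. x (Inl (k, i)) * K $$ (i, j)) * u j)"
        by (simp add: sum_distrib_left mult_ac)
      finally show ?thesis using col[OF kl(1)] by simp
    qed
    have 2: "(\<Sum>i<m. \<Sum>j<m. K $$ (i, j) * (u i * x (Inl (l, j)))) = 0" for u
    proof -
      have "(\<Sum>i<m. \<Sum>j<m. K $$ (i, j) * (u i * x (Inl (l, j)))) =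
          (\<Sum>i<m. u i * (\<Sum>j<m. K $$ (i, j) * x (Inl (l, j))))"
        by (simp add: sum_distrib_left mult_ac)
      then show ?thesis using row[OF kl(2)] by simp
    qed
    have "(\<Sum>i<m. \<Sum>j<m. K $$ (i, j) * ((x (Inl (k, i)) + s * w (Inl (k, i))) *
        (x (Inl (l, j)) + s * w (Inl (l, j))))) =
        (\<Sum>i<m. \<Sum>j<m. K $$ (i, j) * (x (Inl (k, i)) * (x (Inl (l, j)) + s * w (Inl (l, j))))) +
        (\<Sum>i<m. \<Sum>j<m. K $$ (i, j) * (s * w (Inl (k, i)) * x (Inl (l, j)))) + s\<^sup>2 * T k l"
      unfolding T_def sum_distrib_left sum.distrib[symmetric]
      by (intro sum.cong refl) (simp add: power2_eq_square algebra_simps)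
    then show ?thesis unfolding 1 2 by simp
  qed
  have "frob_inner m K (sym_param m n (\<lambda>i. x i + s * w i)) =
      s\<^sup>2 * ((\<Sum>k<n. \<Sum>l<n. M x k l * T k l) + s * (\<Sum>k<n. \<Sum>l<n. M w k l * T k l))" for s
  proof -
    define f where "f i j k l = (M x k l + s * M w k l) * (K $$ (i, j) *
      ((x (Inl (k, i)) + s * w (Inl (k, i))) * (x (Inl (l, j)) + s * w (Inl (l, j)))))" for i j k l
    have "frob_inner m K (sym_param m n (\<lambda>i. x i + s * w i)) = (\<Sum>i<m. \<Sum>j<m. \<Sum>k<n. \<Sum>l<n. f i j k l)"
      unfolding frob_inner_def f_def
      by (intro sum.cong refl) (simp add: sym_param_def M_def sum_distrib_left algebra_simps)
    also have "\<dots> = (\<Sum>i<m. \<Sum>k<n. \<Sum>j<m. \<Sum>l<n. f i j k l)" by (intro sum.cong refl sum.swap)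
    also have "\<dots> = (\<Sum>k<n. \<Sum>i<m. \<Sum>j<m. \<Sum>l<n. f i j k l)" by (rule sum.swap)
    also have "\<dots> = (\<Sum>k<n. \<Sum>i<m. \<Sum>l<n. \<Sum>j<m. f i j k l)" by (intro sum.cong refl sum.swap)
    also have "\<dots> = (\<Sum>k<n. \<Sum>l<n. \<Sum>i<m. \<Sum>j<m. f i j k l)" by (intro sum.cong refl sum.swap)
    also have "\<dots> = (\<Sum>k<n. \<Sum>l<n. (M x k l + s * M w k l) * (s\<^sup>2 * T k l))"
      unfolding f_def sum_distrib_left[symmetric] using bil by (intro sum.cong refl) auto
    finally show ?thesis by (simp add: sum_distrib_left sum.distrib algebra_simps)
  qed
  then show ?thesis by blast
qed

section \<open>Estimability and dimension\<close>

text \<open>The unit cube has measure one, so the whole space is not a null set.\<close>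

lemma AE_PiM_lborel_ex:
  assumes "finite I" "AE x in PiM I (\<lambda>_. lborel :: real measure). P x"
  shows "\<exists>x. P x"
proof (rule ccontr)
  assume "\<nexists>x. P x"
  interpret product_sigma_finite "\<lambda>_. lborel :: real measure" by standard
  let ?M = "PiM I (\<lambda>_. lborel :: real measure)"
  have "AE x in ?M. False" using assms(2) \<open>\<nexists>x. P x\<close> by simp
  then have "emeasure ?M (space ?M) = 0" by (simp add: AE_iff_null_sets[OF sets.top] AE_iff_measurable[OF sets.top])
  moreover have "emeasure ?M (Pi\<^sub>E I (\<lambda>_. {0..1})) \<le> emeasure ?M (space ?M)" by (rule emeasure_space)
  moreover have "emeasure ?M (Pi\<^sub>E I (\<lambda>_. {0..1})) = 1" using emeasure_PiM[OF assms(1), of "\<lambda>_. {0..1}"] by simp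
  ultimately show False by simp
qed

lemma estimable_imp_dense:
  assumes G: "simple_graph m E" and est: "estimable m E n"
    and g: "g \<in> poly_funs (coords m E)" "\<And>A. A \<in> sym_rank_le m n \<Longrightarrow> g (phi m E A) = 0"
  shows "g y = 0"
proof -
  obtain p where "regular m E n p"
    using AE_PiM_lborel_ex[OF _ est[unfolded estimable_def sme_exists_iff_regular[OF G]]] by blast
  then show ?thesis using regular_imp_gram_dense[OF G _ g(1)] g(2) gram_sym_rank_le by blast
qed

text \<open>Density makes the coordinates of \<open>sym_param\<close> algebraically independent. If
  \<open>P * K = 0\<close>, the entries of \<open>K\<close> are the coefficients, up to weights, of
  a vanishing combination of their differentials, so the Jacobian criterion forces
  \<open>K = 0\<close>.\<close>

lemma dense_imp_estimable:
  assumes G: "simple_graph m E"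
    and dense: "\<And>g y. g \<in> poly_funs (coords m E) \<Longrightarrow>
      (\<And>A. A \<in> sym_rank_le m n \<Longrightarrow> g (phi m E A) = 0) \<Longrightarrow> g y = 0"
  shows "estimable m E n"
proof -
  let ?X = "sym_param_vars m n" and ?C = "coords m E"
  have "alg_independent ?C (\<lambda>c x. phi m E (sym_param m n x) c)"
    unfolding alg_independent_def
  proof (intro ballI impI allI)
    fix q y assume q: "q \<in> poly_funs ?C" "\<forall>x. q (\<lambda>c. phi m E (sym_param m n x) c) = 0"
    show "q y = 0"
    proof (rule dense[OF q(1)])
      fix A assume "A \<in> sym_rank_le m n"
      then obtain x where "A = sym_param m n x" using sym_rank_le_sym_param by blast
      then show "q (phi m E A) = 0" using q(2) by simp
    qed
  qed
  moreover have "finite ?X" by (simp add: sym_param_vars_def)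
  ultimately obtain H where H: "H \<in> poly_funs ?X" "\<exists>x. H x \<noteq> 0"
    and crit: "\<And>x u c. H x \<noteq> 0 \<Longrightarrow> c \<in> ?C \<Longrightarrow>
      (\<And>w. ((\<lambda>s. \<Sum>c\<in>?C. u c * phi m E (sym_param m n (\<lambda>i. x i + s * w i)) c) has_real_derivative 0) (at 0))
      \<Longrightarrow> u c = 0"
    using jacobian_criterion[of ?X ?C "\<lambda>c x. phi m E (sym_param m n x) c"]
      phi_sym_param_poly_funs[OF G] finite_coords[OF G] by blast
  obtain x0 where x0: "H x0 \<noteq> 0" using H(2) by blast
  \<comment> \<open>Freezes the \<open>M\<close> part at \<open>x0\<close>, leaving a polynomial in
    \<open>P\<close> alone that is nonzero at the \<open>P\<close> part of
    \<open>x0\<close>.\<close>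
  define e where "e p = case_sum p (\<lambda>z. x0 (Inr z))" for p :: "nat \<times> nat \<Rightarrow> real"
  have reg: "regular m E n p" if Hp: "H (e p) \<noteq> 0" for p
    unfolding regular_def
  proof (intro ballI impI)
    fix K assume K: "K \<in> L_space m E" and ker: "\<forall>k<n. \<forall>j<m. mult_entry m p K (k, j) = 0"
    \<comment> \<open>With these weights the combination is the Frobenius product of
      \<open>K\<close> with \<open>sym_param\<close>.\<close>
    let ?u = "\<lambda>c. phi m E K c * real (entry_mult m c)"
    have "((\<lambda>s. \<Sum>c\<in>?C. ?u c * phi m E (sym_param m n (\<lambda>i. e p i + s * w i)) c)
        has_real_derivative 0) (at 0)" for w
    proof -
      have "(\<lambda>z. e p (Inl z)) = p" by (simp add: e_def)
      then obtain a b where ab: "\<And>s. frob_inner m K (sym_param m n (\<lambda>i. e p i + s * w i)) = s\<^sup>2 * (a + s * b)"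
        using frob_inner_sym_param_line[OF L_space_sym[OF K], of n "e p" w] ker by auto
      have "((\<lambda>s. s\<^sup>2 * (a + s * b)) has_real_derivative 0) (at 0)"
        by (auto intro!: derivative_eq_intros)
      then show ?thesis unfolding frob_inner_L_space[OF G K sym_param_sym, symmetric] ab .
    qed
    then have "?u c = 0" if "c \<in> ?C" for c by (rule crit[OF Hp that])
    then have "phi m E K c = 0" if "c \<in> ?C" for c using entry_mult_pos[OF G that] that by fastforce
    then show "K = 0\<^sub>m m m" by (rule L_space_eq_0[OF G K])
  qed
  have "(\<lambda>p. H (\<lambda>i. e p i)) \<in> poly_funs ({..<n} \<times> {..<m})"
    by (rule poly_funs_compose[OF H(1)])
       (auto simp: e_def sym_param_vars_def intro!: poly_funs.coord poly_funs.const)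
  moreover have "e (\<lambda>z. x0 (Inl z)) = x0" by (rule ext) (simp add: e_def split: sum.split)
  ultimately have "AE p in PiM ({..<n} \<times> {..<m}) (\<lambda>_. lborel). H (e p) \<noteq> 0"
    using poly_funs_AE_nonzero[of "{..<n} \<times> {..<m}" "\<lambda>p. H (e p)" "\<lambda>z. x0 (Inl z)"] x0 by simp
  then show ?thesis
    unfolding estimable_def sme_exists_iff_regular[OF G] by eventually_elim (rule reg)
qed

text \<open>Holding at each single \<open>n\<close>, the equivalence turns both thresholds into the
  least element of the same set.\<close>

lemma estimable_iff_alg_dim:
  assumes G: "simple_graph m E"
  shows "estimable m E n \<longleftrightarrow>
    alg_dim (coords m E) (phi m E ` sym_rank_le m n) = enat (card {..<m} + card E)"
proof -
  have ne: "phi m E ` sym_rank_le m n \<noteq> {}" using gram_sym_rank_le by blast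
  have sub: "phi m E ` sym_rank_le m n \<subseteq> coords m E \<rightarrow>\<^sub>E UNIV" by (auto simp: phi_def)
  show ?thesis
    unfolding card_coords[OF G, symmetric] alg_dim_eq_card_iff[OF finite_coords[OF G] ne sub]
  proof (intro iffI ballI impI allI)
    fix g y assume "estimable m E n" "g \<in> poly_funs (coords m E)" "\<forall>x\<in>phi m E ` sym_rank_le m n. g x = 0"
    then show "g y = 0" using estimable_imp_dense[OF G, of n g y] by simp
  next
    assume "\<forall>g\<in>poly_funs (coords m E). (\<forall>x\<in>phi m E ` sym_rank_le m n. g x = 0) \<longrightarrow> (\<forall>y. g y = 0)"
    then show "estimable m E n" by (intro dense_imp_estimable[OF G]) simp
  qed
qed

theorem theorem6p3:
  fixes m :: nat and E :: "nat set set"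
  assumes "simple_graph m E"
  shows "smt m E = graph_rank m E"
  unfolding smt_def graph_rank_def estimable_iff_alg_dim[OF assms] by (rule refl)

end
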